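(* Assume that $X$, $B$ and $Y$ are Banach spaces such that the embedding $X\hookrightarrow B$ is compact and the embedding $B\hookrightarrow Y$ is continuous. Let $T>0$, $1\le p\le\infty$, $0<\alpha<1$, and let $\{f^{(\tau)}\}$ be a sequence of piecewise constant functions (with $f^{(\tau)}$ piecewise constant on the uniform partition of $[0,T]$ of step $\tau$), satisfying $$\|f^{(\tau)}\|_{L^p(0,T;X)}+\|D^\alpha_\tau f^{(\tau)}\|_{L^p(0,T;Y)}\le C_0,$$ where $C_0$ is a constant independent of $\tau$ and $D^\alpha_\tau$ is the discrete Caputo derivative. Then $\{f^{(\tau)}\}$ is relatively compact in $L^p(0,T;B)$.
   Context: Let $N\in\mathbb{N}$, $\tau=T/N$, $t_k=k\tau$ for $k=0,\dots,N$. A piecewise constant function $f^{(\tau)}$ with values $f_0,f_1,\dots,f_N$ (with $f_0\in Y$ and $f_k\in X$ for $k\ge1$) is $f^{(\tau)}(t)=f_k$ for $t\in(t_{k-1},t_k]$, $k=1,\dots,N$, and $f^{(\tau)}(0)=f_0$. $\Gamma_\alpha$ is the Gamma function at $\alpha$. The sequence $\{\lambda_k\}_{k\ge1}$ is defined by $\lambda_1=1$ and $$\lambda_{k+1}=\sum_{j=1}^k\big((k-j+1)^{\alpha-1}-(k-j+2)^{\alpha-1}\big)\lambda_j,\quad k\ge1.$$ The discrete Caputo derivative is $$(D^\alpha_\tau f)_k=\Gamma_\alpha\tau^{-\alpha}\sum_{j=0}^{k-1}\lambda_{k-j}(f_{j+1}-f_j),\quad 1\le k\le N,$$ and $D^\alpha_\tau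 f^{(\tau)}(t)=(D^\alpha_\tau f)_k$ for $t\in(t_{k-1},t_k]$, $k=1,\dots,N$. *)

theory Defs
  imports "HOL-Analysis.Analysis" "HOL-Probability.Essential_Supremum"
begin

section \<open>Embeddings of Banach spaces\<close>

text \<open>
  An inclusion between Banach spaces is represented by an injective linear map between types.
\<close>

definition continuous_embedding :: "('a::real_normed_vector \<Rightarrow> 'b::real_normed_vector) \<Rightarrow> bool" where
  "continuous_embedding i \<longleftrightarrow> bounded_linear i \<and> inj i"

definition compact_embedding :: "('a::real_normed_vector \<Rightarrow> 'b::real_normed_vector) \<Rightarrow> bool" where
  "compact_embedding i \<longleftrightarrow>
     continuous_embedding i \<and> (\<forall>S. bounded S \<longrightarrow> compact (closure (i ` S)))"


section \<open>Bochner--Lebesgue spaces\<close>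

text \<open>
  The Bochner integral of the library is restricted to second-countable spaces, so strong
  measurability is defined here for functions into an arbitrary normed space.  The space
  consists of classes of strongly measurable functions modulo equality almost everywhere.
  The norm of the difference does not depend on the representatives (lemma
  \<open>Lp_dist_class\<close> below), so the infimum in \<open>Lp_dist\<close> is over a constant.
\<close>

definition strongly_measurable :: "'a measure \<Rightarrow> ('a \<Rightarrow> 'b::real_normed_vector) \<Rightarrow> bool" where
  "strongly_measurable M f \<longleftrightarrow>
     (\<exists>s. (\<forall>n. simple_function M (s n)) \<and> (AE x in M. (\<lambda>n. s n x) \<longlonglongrightarrow> f x))"

definition Lp_norm :: "ennreal \<Rightarrow> 'a measure \<Rightarrow> ('a \<Rightarrow> 'b::real_normed_vector) \<Rightarrow> ennreal" where
  "Lp_norm p M f =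
     (if p = \<infinity> then esssup M (\<lambda>x. ennreal (norm (f x)))
      else let I = \<integral>\<^sup>+ x. ennreal (norm (f x) powr enn2real p) \<partial>M
           in if I = \<infinity> then \<infinity> else ennreal (enn2real I powr (1 / enn2real p)))"

definition Lp_fun :: "ennreal \<Rightarrow> 'a measure \<Rightarrow> ('a \<Rightarrow> 'b::real_normed_vector) set" where
  "Lp_fun p M = {f. strongly_measurable M f \<and> Lp_norm p M f < \<infinity>}"

definition Lp_rel ::
    "ennreal \<Rightarrow> 'a measure \<Rightarrow> (('a \<Rightarrow> 'b::real_normed_vector) \<times> ('a \<Rightarrow> 'b)) set" where
  "Lp_rel p M = {(f, g). f \<in> Lp_fun p M \<and> g \<in> Lp_fun p M \<and> (AE x in M. f x = g x)}"

definition Lp_class ::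
    "ennreal \<Rightarrow> 'a measure \<Rightarrow> ('a \<Rightarrow> 'b::real_normed_vector) \<Rightarrow> ('a \<Rightarrow> 'b) set" where
  "Lp_class p M f = Lp_rel p M `` {f}"

definition Lp_space :: "ennreal \<Rightarrow> 'a measure \<Rightarrow> ('a \<Rightarrow> 'b::real_normed_vector) set set" where
  "Lp_space p M = Lp_fun p M // Lp_rel p M"

definition Lp_dist ::
    "ennreal \<Rightarrow> 'a measure \<Rightarrow> ('a \<Rightarrow> 'b::real_normed_vector) set \<Rightarrow> ('a \<Rightarrow> 'b) set \<Rightarrow> real" where
  "Lp_dist p M U V =
     enn2real (INF f\<in>U. INF g\<in>V. Lp_norm p M (\<lambda>x. f x - g x))"

definition Lp_topology ::
    "ennreal \<Rightarrow> 'a measure \<Rightarrow> ('a \<Rightarrow> 'b::real_normed_vector) set topology" where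
  "Lp_topology p M = Metric_space.mtopology (Lp_space p M) (Lp_dist p M)"

definition relatively_compactin :: "'a topology \<Rightarrow> 'a set \<Rightarrow> bool" where
  "relatively_compactin X S \<longleftrightarrow> S \<subseteq> topspace X \<and> compactin X (X closure_of S)"


subsection \<open>The quotient is a metric space\<close>

lemma strongly_measurable_diff:
  assumes "strongly_measurable M f" "strongly_measurable M g"
  shows "strongly_measurable M (\<lambda>x. f x - g x)"
proof -
  obtain s t where s: "\<And>n. simple_function M (s n)" "AE x in M. (\<lambda>n. s n x) \<longlonglongrightarrow> f x"
    and t: "\<And>n. simple_function M (t n)" "AE x in M. (\<lambda>n. t n x) \<longlonglongrightarrow> g x"
    using assms unfolding strongly_measurable_def by blast
  have "simple_function M (\<lambda>x. s n x - t n x)" for n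
    by (rule simple_function_compose2[OF s(1) t(1)])
  moreover have "AE x in M. (\<lambda>n. s n x - t n x) \<longlonglongrightarrow> f x - g x"
    using s(2) t(2) by eventually_elim (rule tendsto_diff)
  ultimately show ?thesis
    unfolding strongly_measurable_def by (intro exI[of _ "\<lambda>n x. s n x - t n x"]) auto
qed

lemma complete_measure_lebesgue_on:
  assumes "S \<in> sets lebesgue"
  shows "complete_measure (lebesgue_on S)"
proof
  fix A B :: "'a set"
  assume "A \<subseteq> B" "B \<in> null_sets (lebesgue_on S)"
  then show "A \<in> sets (lebesgue_on S)"
    using assms null_sets_restrict_space[of S lebesgue]
    by (metis (no_types, lifting) completion.complete2 null_setsD2 order_trans)
qed

lemma (in complete_measure) measurable_AE_cong:
  fixes f g :: "'a \<Rightarrow> real"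
  assumes f: "f \<in> borel_measurable M" and eq: "AE x in M. f x = g x"
  shows "g \<in> borel_measurable M"
proof (rule measurableI)
  fix A :: "real set" assume A: "A \<in> sets borel"
  have sets: "f -` A \<inter> space M \<in> sets M" using f A by (rule measurable_sets)
  have AE: "AE x in M. x \<in> f -` A \<inter> space M \<longleftrightarrow> x \<in> g -` A \<inter> space M"
    using eq by eventually_elim auto
  show "g -` A \<inter> space M \<in> sets M"
    by (rule in_sets_AE[OF AE sets]) simp
qed auto

lemma (in complete_measure) strongly_measurable_norm:
  assumes "strongly_measurable M f"
  shows "(\<lambda>x. norm (f x)) \<in> borel_measurable M"
proof -
  obtain s where s: "\<And>n. simple_function M (s n)" "AE x in M. (\<lambda>n. s n x) \<longlonglongrightarrow> f x"
    using assms unfolding strongly_measurable_def by blast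
  have m[measurable]: "(\<lambda>x. norm (s n x)) \<in> borel_measurable M" for n
    by (rule borel_measurable_simple_function)
       (rule simple_function_compose1[OF s(1)])
  have "(\<lambda>x. lim (\<lambda>n. norm (s n x))) \<in> borel_measurable M" by measurable
  moreover have "AE x in M. lim (\<lambda>n. norm (s n x)) = norm (f x)"
    using s(2) by eventually_elim (auto intro!: limI tendsto_norm)
  ultimately show ?thesis by (rule measurable_AE_cong)
qed

lemma Lp_norm_AE_cong:
  assumes "(\<lambda>x. norm (f x)) \<in> borel_measurable M" "(\<lambda>x. norm (g x)) \<in> borel_measurable M"
    and eq: "AE x in M. f x = g x"
  shows "Lp_norm p M f = Lp_norm p M g"
proof -
  have "(\<integral>\<^sup>+ x. ennreal (norm (f x) powr enn2real p) \<partial>M)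
      = (\<integral>\<^sup>+ x. ennreal (norm (g x) powr enn2real p) \<partial>M)"
    by (rule nn_integral_cong_AE) (use eq in eventually_elim, simp)
  moreover have "esssup M (\<lambda>x. ennreal (norm (f x))) = esssup M (\<lambda>x. ennreal (norm (g x)))"
    by (rule esssup_AE_cong) (use assms in measurable, use eq in eventually_elim, simp)
  ultimately show ?thesis by (simp add: Lp_norm_def)
qed

lemma Lp_norm_le_iff:
  fixes c :: real
  assumes p: "1 \<le> p" "p \<noteq> \<infinity>" and c: "0 \<le> c"
  shows "Lp_norm p M f \<le> ennreal c \<longleftrightarrow>
    (\<integral>\<^sup>+ x. ennreal (norm (f x) powr enn2real p) \<partial>M) \<le> ennreal (c powr enn2real p)"
proof -
  define q where "q = enn2real p"
  define I where "I = (\<integral>\<^sup>+ x. ennreal (norm (f x) powr q) \<partial>M)"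
  have q: "1 \<le> q" using p unfolding q_def by (cases p) (auto simp: top_ennreal_def)
  show ?thesis
  proof (cases "I = \<infinity>")
    case True
    then show ?thesis using p by (simp add: Lp_norm_def Let_def flip: q_def I_def) (simp add: top_unique)
  next
    case False
    then obtain r where r: "0 \<le> r" "I = ennreal r" by (cases I) auto
    have "r powr (1/q) \<le> c \<longleftrightarrow> r \<le> c powr q"
    proof
      assume "r powr (1/q) \<le> c"
      then have "(r powr (1/q)) powr q \<le> c powr q" using q by (intro powr_mono2) auto
      then show "r \<le> c powr q" using q r by (simp add: powr_powr)
    next
      assume "r \<le> c powr q"
      then have "r powr (1/q) \<le> (c powr q) powr (1/q)" using q r by (intro powr_mono2) auto
      then show "r powr (1/q) \<le> c" using q c by (simp add: powr_powr)
    qed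
    then show ?thesis using p r c by (simp add: Lp_norm_def Let_def flip: q_def I_def)
  qed
qed

lemma powr_convex_combination:
  fixes x y a b q :: real
  assumes "0 \<le> x" "0 \<le> y" "0 < a" "0 < b" "1 \<le> q"
  shows "((x + y) / (a + b)) powr q
     \<le> (a / (a + b)) * (x powr q / a powr q) + (b / (a + b)) * (y powr q / b powr q)"
proof -
  have le: "(u * z) powr q \<le> u * z powr q" if "0 \<le> u" "u \<le> 1" "0 \<le> z" for u z :: real
  proof -
    have "u powr q \<le> u" using that assms(5)
      by (cases "u = 0") (auto intro: order_trans[OF powr_mono'[of 1 q u]])
    then show ?thesis using that by (simp add: powr_mult mult_right_mono)
  qed
  define u v where "u = a / (a + b)" and "v = b / (a + b)"
  have uv: "0 \<le> u" "0 \<le> v" "u \<le> 1" "v \<le> 1"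
    using assms by (auto simp: u_def v_def field_simps)
  have uv1: "u + v = 1"
    using assms by (simp add: u_def v_def flip: add_divide_distrib)
  have eq: "(x + y) / (a + b) = u * (x / a) + v * (y / b)"
    using assms by (simp add: u_def v_def add_divide_distrib)
  have "(u * (x / a) + v * (y / b)) powr q \<le> u * (x / a) powr q + v * (y / b) powr q"
  proof (cases "x = 0 \<or> y = 0")
    case True
    then show ?thesis using le[of u "x / a"] le[of v "y / b"] uv assms by auto
  next
    case False
    then show ?thesis
      using convex_onD[OF powr_convex[OF assms(5)], of v "x / a" "y / b"] uv uv1 assms
      by (simp add: eq_diff_eq[symmetric])
  qed
  then show ?thesis
    using assms unfolding eq by (simp add: powr_divide u_def v_def)
qed

lemma Lp_norm_triangle:
  assumes p: "1 \<le> p"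
    and mf[measurable]: "(\<lambda>x. norm (f x)) \<in> borel_measurable M"
    and mg[measurable]: "(\<lambda>x. norm (g x)) \<in> borel_measurable M"
    and mh[measurable]: "(\<lambda>x. norm (h x)) \<in> borel_measurable M"
    and le: "\<And>x. norm (h x) \<le> norm (f x) + norm (g x)"
  shows "Lp_norm p M h \<le> Lp_norm p M f + Lp_norm p M g"
proof (cases "p = \<infinity>")
  case True
  have "AE x in M. ennreal (norm (h x)) \<le> Lp_norm p M f + Lp_norm p M g"
    using esssup_AE[of "\<lambda>x. ennreal (norm (f x))" M] esssup_AE[of "\<lambda>x. ennreal (norm (g x))" M]
  proof eventually_elim
    case (elim x)
    have "ennreal (norm (h x)) \<le> ennreal (norm (f x)) + ennreal (norm (g x))"
      using le[of x] by (simp flip: ennreal_plus)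
    also have "\<dots> \<le> Lp_norm p M f + Lp_norm p M g"
      using elim True by (simp add: Lp_norm_def add_mono)
    finally show ?case .
  qed
  then have "esssup M (\<lambda>x. ennreal (norm (h x))) \<le> Lp_norm p M f + Lp_norm p M g"
    by (intro esssup_I) auto
  then show ?thesis by (subst Lp_norm_def) (simp add: True)
next
  case False
  show ?thesis
  proof (cases "Lp_norm p M f = \<infinity> \<or> Lp_norm p M g = \<infinity>")
    case True
    then show ?thesis by auto
  next
    case fin: False
    define q where "q = enn2real p"
    have q: "1 \<le> q" using p False unfolding q_def by (cases p) (auto simp: top_ennreal_def)
    obtain a0 where a0: "0 \<le> a0" "Lp_norm p M f = ennreal a0" using fin by (cases "Lp_norm p M f") auto
    obtain b0 where b0: "0 \<le> b0" "Lp_norm p M g = ennreal b0" using fin by (cases "Lp_norm p M g") auto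
    have *: "Lp_norm p M h \<le> ennreal (a0 + b0 + e)" if e: "0 < e" for e :: real
    proof -
      define a b where "a = a0 + e / 2" and "b = b0 + e / 2"
      have ab: "0 < a" "0 < b" "a0 \<le> a" "b0 \<le> b" "a + b = a0 + b0 + e"
        using a0 b0 e by (auto simp: a_def b_def)
      have If: "(\<integral>\<^sup>+ x. ennreal (norm (f x) powr q) \<partial>M) \<le> ennreal (a powr q)"
        using Lp_norm_le_iff[OF p False, of a M f] ab a0 by (simp add: q_def ennreal_leI)
      have Ig: "(\<integral>\<^sup>+ x. ennreal (norm (g x) powr q) \<partial>M) \<le> ennreal (b powr q)"
        using Lp_norm_le_iff[OF p False, of b M g] ab b0 by (simp add: q_def ennreal_leI)
      define A B where "A = (a + b) powr q * (a / (a + b)) / a powr q"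
        and "B = (a + b) powr q * (b / (a + b)) / b powr q"
      have AB: "0 \<le> A" "0 \<le> B" using ab by (auto simp: A_def B_def)
      have pt: "norm (h x) powr q \<le> A * norm (f x) powr q + B * norm (g x) powr q" for x
      proof -
        have "norm (h x) powr q \<le> (norm (f x) + norm (g x)) powr q"
          using le[of x] q by (intro powr_mono2) auto
        also have "\<dots> = (a + b) powr q * ((norm (f x) + norm (g x)) / (a + b)) powr q"
          using ab by (simp add: powr_divide)
        also have "\<dots> \<le> (a + b) powr q * ((a / (a + b)) * (norm (f x) powr q / a powr q)
            + (b / (a + b)) * (norm (g x) powr q / b powr q))"
          using powr_convex_combination[of "norm (f x)" "norm (g x)" a b q] ab q
          by (intro mult_left_mono) auto
        also have "\<dots> = A * norm (f x) powr q + B * norm (g x) powr q"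
          unfolding A_def B_def distrib_left by (simp add: mult_ac)
        finally show ?thesis .
      qed
      have "(\<integral>\<^sup>+ x. ennreal (norm (h x) powr q) \<partial>M)
          \<le> (\<integral>\<^sup>+ x. (ennreal A * ennreal (norm (f x) powr q) + ennreal B * ennreal (norm (g x) powr q)) \<partial>M)"
        using pt AB by (intro nn_integral_mono) (simp add: ennreal_leI flip: ennreal_plus ennreal_mult)
      also have "\<dots> = ennreal A * (\<integral>\<^sup>+ x. ennreal (norm (f x) powr q) \<partial>M)
          + ennreal B * (\<integral>\<^sup>+ x. ennreal (norm (g x) powr q) \<partial>M)"
        by (simp add: nn_integral_add nn_integral_cmult)
      also have "\<dots> \<le> ennreal A * ennreal (a powr q) + ennreal B * ennreal (b powr q)"
        by (intro add_mono mult_left_mono If Ig) auto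
      also have "\<dots> = ennreal (A * a powr q + B * b powr q)"
        using AB by (simp add: ennreal_plus ennreal_mult)
      also have "A * a powr q + B * b powr q = (a + b) powr q"
      proof -
        have "A * a powr q + B * b powr q = (a + b) powr q * (a / (a + b) + b / (a + b))"
          using ab unfolding A_def B_def by (simp add: distrib_left)
        also have "a / (a + b) + b / (a + b) = 1"
          using ab(1,2) by (simp flip: add_divide_distrib)
        finally show ?thesis by simp
      qed
      finally show ?thesis
        using Lp_norm_le_iff[OF p False, of "a + b" M h] ab by (simp add: q_def)
    qed
    have "Lp_norm p M h \<le> ennreal (a0 + b0)"
    proof (rule ennreal_le_epsilon)
      fix e :: real assume "0 < e"
      then show "Lp_norm p M h \<le> ennreal (a0 + b0) + ennreal e"
        using *[of e] a0 b0 by (simp add: ennreal_plus)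
    qed
    then show ?thesis using a0 b0 by (simp add: ennreal_plus)
  qed
qed

lemma Lp_norm_eq_0:
  assumes p: "1 \<le> p" and m[measurable]: "(\<lambda>x. norm (f x)) \<in> borel_measurable M"
  shows "Lp_norm p M f = 0 \<longleftrightarrow> (AE x in M. f x = 0)"
proof (cases "p = \<infinity>")
  case True
  have "esssup M (\<lambda>x. ennreal (norm (f x))) = 0 \<longleftrightarrow> (AE x in M. f x = 0)"
  proof
    assume "esssup M (\<lambda>x. ennreal (norm (f x))) = 0"
    then show "AE x in M. f x = 0"
      using esssup_AE[of "\<lambda>x. ennreal (norm (f x))" M] by simp
  next
    assume "AE x in M. f x = 0"
    then have "esssup M (\<lambda>x. ennreal (norm (f x))) \<le> 0"
      by (intro esssup_I) auto
    then show "esssup M (\<lambda>x. ennreal (norm (f x))) = 0" by simp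
  qed
  then show ?thesis by (simp add: Lp_norm_def True)
next
  case False
  have "Lp_norm p M f = 0 \<longleftrightarrow> Lp_norm p M f \<le> ennreal 0" by simp
  also have "\<dots> \<longleftrightarrow> (\<integral>\<^sup>+ x. ennreal (norm (f x) powr enn2real p) \<partial>M) = 0"
    by (subst Lp_norm_le_iff[OF p False]) auto
  also have "\<dots> \<longleftrightarrow> (AE x in M. f x = 0)"
    by (subst nn_integral_0_iff_AE) (auto simp: ennreal_eq_0_iff)
  finally show ?thesis .
qed

lemma Lp_norm_minus_commute: "Lp_norm p M (\<lambda>x. f x - g x) = Lp_norm p M (\<lambda>x. g x - f x)"
  by (simp add: Lp_norm_def norm_minus_commute)

lemma equiv_Lp_rel: "equiv (Lp_fun p M) (Lp_rel p M)"
  by (auto simp: equiv_def refl_on_def sym_def trans_def Lp_rel_def elim: eventually_mono elim: eventually_elim2)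

context complete_measure
begin

lemma Lp_dist_class:
  assumes f: "f \<in> Lp_fun p M" and g: "g \<in> Lp_fun p M"
  shows "Lp_dist p M (Lp_class p M f) (Lp_class p M g) = enn2real (Lp_norm p M (\<lambda>x. f x - g x))"
proof -
  have eq: "Lp_norm p M (\<lambda>x. u x - v x) = Lp_norm p M (\<lambda>x. f x - g x)"
    if "(f, u) \<in> Lp_rel p M" "(g, v) \<in> Lp_rel p M" for u v
  proof (rule Lp_norm_AE_cong)
    have sm: "strongly_measurable M f" "strongly_measurable M g" "strongly_measurable M u"
      "strongly_measurable M v" "AE x in M. f x = u x" "AE x in M. g x = v x"
      using that by (auto simp: Lp_rel_def Lp_fun_def)
    then show "(\<lambda>x. norm (u x - v x)) \<in> borel_measurable M"
      "(\<lambda>x. norm (f x - g x)) \<in> borel_measurable M"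
      by (auto intro!: strongly_measurable_norm strongly_measurable_diff)
    show "AE x in M. u x - v x = f x - g x"
      using sm(5,6) by eventually_elim simp
  qed
  have ne: "f \<in> Lp_class p M f" "g \<in> Lp_class p M g"
    using f g by (auto simp: Lp_rel_def Lp_class_def)
  have "(INF u\<in>Lp_class p M f. INF v\<in>Lp_class p M g. Lp_norm p M (\<lambda>x. u x - v x))
      = (INF u\<in>Lp_class p M f. INF v\<in>Lp_class p M g. Lp_norm p M (\<lambda>x. f x - g x))"
    by (intro INF_cong refl eq) (simp_all add: Lp_class_def)
  also have "\<dots> = Lp_norm p M (\<lambda>x. f x - g x)"
    using ne by (metis INF_const empty_iff)
  finally show ?thesis by (simp add: Lp_dist_def)
qed

lemma Lp_norm_diff_triangle:
  assumes p: "1 \<le> p" and "f \<in> Lp_fun p M" "g \<in> Lp_fun p M" "h \<in> Lp_fun p M"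
  shows "Lp_norm p M (\<lambda>x. f x - h x) \<le> Lp_norm p M (\<lambda>x. f x - g x) + Lp_norm p M (\<lambda>x. g x - h x)"
proof (rule Lp_norm_triangle[OF p])
  fix x
  show "norm (f x - h x) \<le> norm (f x - g x) + norm (g x - h x)"
    using norm_triangle_ineq[of "f x - g x" "g x - h x"] by simp
qed (use assms in \<open>auto simp: Lp_fun_def intro!: strongly_measurable_norm strongly_measurable_diff\<close>)

lemma Lp_norm_diff_finite:
  assumes p: "1 \<le> p" and "f \<in> Lp_fun p M" "g \<in> Lp_fun p M"
  shows "Lp_norm p M (\<lambda>x. f x - g x) < \<infinity>"
proof -
  have "Lp_norm p M (\<lambda>x. f x - g x) \<le> Lp_norm p M f + Lp_norm p M g"
    by (rule Lp_norm_triangle[OF p])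
       (use assms in \<open>auto simp: Lp_fun_def norm_triangle_ineq4
          intro!: strongly_measurable_norm strongly_measurable_diff\<close>)
  also have "\<dots> < \<infinity>" using assms by (auto simp: Lp_fun_def)
  finally show ?thesis .
qed

lemma Lp_spaceE:
  assumes "U \<in> Lp_space p M"
  obtains f where "f \<in> Lp_fun p M" "U = Lp_class p M f"
  using assms unfolding Lp_space_def Lp_class_def by (auto elim: quotientE)

lemma Metric_space_Lp:
  fixes p :: ennreal
  assumes p: "1 \<le> p"
  shows "Metric_space (Lp_space p M :: ('a \<Rightarrow> 'b::real_normed_vector) set set) (Lp_dist p M)"
proof -
  show ?thesis
  proof
    fix U V :: "('a \<Rightarrow> 'b) set"
    show "0 \<le> Lp_dist p M U V" by (simp add: Lp_dist_def)
    show "Lp_dist p M U V = Lp_dist p M V U"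
      unfolding Lp_dist_def
      by (subst INF_commute) (intro arg_cong[where f = enn2real] INF_cong refl Lp_norm_minus_commute)
  next
    fix U V :: "('a \<Rightarrow> 'b) set"
    assume "U \<in> Lp_space p M" "V \<in> Lp_space p M"
    then obtain f g where f: "f \<in> Lp_fun p M" "U = Lp_class p M f"
      and g: "g \<in> Lp_fun p M" "V = Lp_class p M g"
      by (meson Lp_spaceE)
    have m: "(\<lambda>x. norm (f x - g x)) \<in> borel_measurable M"
      using f g by (auto simp: Lp_fun_def intro!: strongly_measurable_norm strongly_measurable_diff)
    have "Lp_dist p M U V = 0 \<longleftrightarrow> Lp_norm p M (\<lambda>x. f x - g x) = 0"
      using Lp_norm_diff_finite[OF p f(1) g(1)] f g by (auto simp: Lp_dist_class enn2real_eq_0_iff)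
    also have "\<dots> \<longleftrightarrow> (f, g) \<in> Lp_rel p M"
      using Lp_norm_eq_0[OF p m] f g by (simp add: Lp_rel_def)
    also have "\<dots> \<longleftrightarrow> U = V"
      using eq_equiv_class_iff[OF equiv_Lp_rel f(1) g(1)] f(2) g(2) by (simp add: Lp_class_def)
    finally show "Lp_dist p M U V = 0 \<longleftrightarrow> U = V" .
  next
    fix U V W :: "('a \<Rightarrow> 'b) set"
    assume "U \<in> Lp_space p M" "V \<in> Lp_space p M" "W \<in> Lp_space p M"
    then obtain f g h where f: "f \<in> Lp_fun p M" "U = Lp_class p M f"
      and g: "g \<in> Lp_fun p M" "V = Lp_class p M g"
      and h: "h \<in> Lp_fun p M" "W = Lp_class p M h"
      by (meson Lp_spaceE)
    have "enn2real (Lp_norm p M (\<lambda>x. f x - h x))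
        \<le> enn2real (Lp_norm p M (\<lambda>x. f x - g x) + Lp_norm p M (\<lambda>x. g x - h x))"
      by (rule enn2real_mono[OF Lp_norm_diff_triangle])
         (use p f g h Lp_norm_diff_finite in auto)
    also have "\<dots> = enn2real (Lp_norm p M (\<lambda>x. f x - g x)) + enn2real (Lp_norm p M (\<lambda>x. g x - h x))"
      by (rule enn2real_plus) (use p f g h Lp_norm_diff_finite in auto)
    finally show "Lp_dist p M U W \<le> Lp_dist p M U V + Lp_dist p M V W"
      using f g h by (simp add: Lp_dist_class)
  qed
qed

end


section \<open>Piecewise constant functions and the discrete Caputo derivative\<close>

text \<open>
  The piecewise constant function of step \<open>\<tau>\<close> takes the value \<open>v k\<close> on
  \<open>(t\<^sub>k\<^sub>-\<^sub>1, t\<^sub>k]\<close>, where \<open>t\<^sub>k = k \<tau>\<close>, and \<open>v 0\<close> at \<open>0\<close>.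
\<close>

definition piecewise_const :: "real \<Rightarrow> (nat \<Rightarrow> 'a) \<Rightarrow> real \<Rightarrow> 'a" where
  "piecewise_const \<tau> v t = v (nat \<lceil>t / \<tau>\<rceil>)"

lemma piecewise_const_0: "piecewise_const \<tau> v 0 = v 0"
  by (simp add: piecewise_const_def)

lemma piecewise_const_eq:
  assumes "0 < \<tau>" "1 \<le> k" "t \<in> {real (k - 1) * \<tau> <.. real k * \<tau>}"
  shows "piecewise_const \<tau> v t = v k"
proof -
  have "\<lceil>t / \<tau>\<rceil> = int k"
    using assms by (intro ceiling_unique) (auto simp: of_nat_diff field_simps)
  then show ?thesis by (simp add: piecewise_const_def)
qed

text \<open>The weights are indexed from \<open>1\<close>; the value at \<open>0\<close> is a dummy.\<close>

fun caputo_weight :: "real \<Rightarrow> nat \<Rightarrow> real" where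
  "caputo_weight \<alpha> 0 = 0"
| "caputo_weight \<alpha> (Suc 0) = 1"
| "caputo_weight \<alpha> (Suc (Suc m)) =
     (let k = Suc m in
       \<Sum>j = 1..k. (real (k - j + 1) powr (\<alpha> - 1) - real (k - j + 2) powr (\<alpha> - 1))
         * caputo_weight \<alpha> j)"

definition discrete_caputo :: "real \<Rightarrow> real \<Rightarrow> (nat \<Rightarrow> 'a::real_normed_vector) \<Rightarrow> nat \<Rightarrow> 'a" where
  "discrete_caputo \<alpha> \<tau> v k =
     (Gamma \<alpha> * \<tau> powr (- \<alpha>)) *\<^sub>R (\<Sum>j<k. caputo_weight \<alpha> (k - j) *\<^sub>R (v (j + 1) - v j))"

end

theory Submission
  imports Defs
begin

text \<open>
  Why the family is relatively compact. Write \<open>g = j \<circ> i \<circ> f\<close> for the grid values seen in the largest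
  space. The weights \<open>\<lambda>\<close> of the discrete derivative are, by their recursion, the convolution inverse
  of \<open>r\<^sup>\<alpha>\<^sup>-\<^sup>1\<close> up to summation, so the derivative can be inverted explicitly: \<open>g m - g 0\<close> is the discrete
  fractional integral of order \<open>\<alpha>\<close> of \<open>D = D\<^sup>\<alpha>g\<close> (lemma \<open>discrete_caputo_inversion\<close>). A shift of the
  grid function by \<open>d\<close> steps therefore convolves \<open>D\<close> with a difference of kernels, whose total mass
  is a constant times \<open>(d \<tau>)\<^sup>\<alpha>\<close> after telescoping. By Minkowski's inequality the shifts of \<open>g\<close> are small
  in \<open>L\<^sup>p(Y)\<close>, uniformly in the step \<open>\<tau>\<close> and whatever the initial value is
  (lemma \<open>discrete_caputo_shift_estimate\<close>).
  
  Fix a coarse grid of \<open>M\<close> cells and replace \<open>f\<close> on each cell by the average \<open>A\<close> of about \<open>N/M\<close>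
  neighbouring values. The error \<open>f - A\<close> is dominated pointwise by a mean of shift differences, so it
  is small in \<open>L\<^sup>p(Y)\<close> for large \<open>M\<close>, and it is bounded in \<open>L\<^sup>p(X)\<close> independently of \<open>M\<close>
  (lemma \<open>block_average_error\<close>). Compactness of the first embedding gives Ehrling's inequality
  \<open>|i x| \<le> \<epsilon> |x| + C |j (i x)|\<close>, and with it smallness in \<open>L\<^sup>p(B)\<close>. Only the fine grids with fewer
  than \<open>M (M + 1)\<close> cells escape this argument, and there \<open>f\<close> itself takes the role of \<open>A\<close>. Hence, up to
  a small error, every member of the family takes boundedly many values in a bounded set of \<open>X\<close> on one of
  finitely many grids; since this set is relatively compact in \<open>B\<close>, the family is totally bounded
  (lemmas \<open>coarse_approximation\<close> and \<open>finite_colouring\<close>).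
  
  Total boundedness becomes relative compactness because Cauchy sequences in the family converge.
  All members are simple functions, so an almost everywhere limit of a rapidly converging
  subsequence is strongly measurable by definition, and it is the \<open>L\<^sup>p\<close> limit
  (lemma \<open>Lp_Cauchy_simple_convergent\<close>).
  
  The exponent \<open>p = \<infinity>\<close> goes through together with the finite ones: the shift and averaging estimates use
  the norm only through monotonicity, Minkowski's inequality for finite sums, and its behaviour under
  injective reindexing of the grid.
\<close>


section \<open>Norms of functions with values in a normed space\<close>

lemma enn2real_ge_1:
  fixes p :: ennreal
  assumes "1 \<le> p" "p \<noteq> \<infinity>"
  shows "1 \<le> enn2real p"
  using assms by (cases p) (auto simp: top_ennreal_def)

lemma Lp_norm_of_norm: "Lp_norm p M (\<lambda>x. norm (h x)) = Lp_norm p M h"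
  by (simp add: Lp_norm_def)

lemma Lp_norm_mono_AE:
  assumes m: "(\<lambda>x. norm (f x)) \<in> borel_measurable M"
    and le: "AE x in M. norm (f x) \<le> norm (g x)"
  shows "Lp_norm p M f \<le> Lp_norm p M g"
proof (cases "p = \<infinity>")
  case True
  have "esssup M (\<lambda>x. ennreal (norm (f x))) \<le> esssup M (\<lambda>x. ennreal (norm (g x)))"
    by (rule esssup_AE_mono) (use m in measurable, use le in \<open>auto intro: ennreal_leI\<close>)
  then show ?thesis by (simp add: Lp_norm_def True)
next
  case False
  define I where "I h = (\<integral>\<^sup>+ x. ennreal (norm (h x) powr enn2real p) \<partial>M)" for h :: "'a \<Rightarrow> real"
  have "I (\<lambda>x. norm (f x)) \<le> I (\<lambda>x. norm (g x))"
    unfolding I_def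
    by (rule nn_integral_mono_AE) (use le in eventually_elim, auto intro!: ennreal_leI powr_mono2)
  then show ?thesis
    using False
    by (auto simp: Lp_norm_def Let_def I_def top_unique less_top
        intro!: ennreal_leI powr_mono2 enn2real_mono)
qed

lemma Lp_norm_scale_le:
  assumes p: "1 \<le> p" and b: "0 \<le> b" and c: "0 \<le> c"
    and m[measurable]: "(\<lambda>x. norm (f x)) \<in> borel_measurable M"
    and le: "Lp_norm p M f \<le> ennreal b"
  shows "Lp_norm p M (\<lambda>x. c * norm (f x)) \<le> ennreal (c * b)"
proof (cases "p = \<infinity>")
  case True
  have "esssup M (\<lambda>x. ennreal (norm (f x))) \<le> ennreal b"
    using le by (simp add: Lp_norm_def True)
  then have "AE x in M. ennreal (norm (f x)) \<le> ennreal b"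
    using esssup_AE[of "\<lambda>x. ennreal (norm (f x))" M] by (auto elim: eventually_mono)
  then have "AE x in M. ennreal (norm (c * norm (f x))) \<le> ennreal (c * b)"
    by eventually_elim (use b c in \<open>auto simp: abs_mult intro!: ennreal_leI mult_left_mono\<close>)
  then have "esssup M (\<lambda>x. ennreal (norm (c * norm (f x)))) \<le> ennreal (c * b)"
    by (intro esssup_I) auto
  then show ?thesis by (simp add: Lp_norm_def True)
next
  case False
  define q where "q = enn2real p"
  have "(\<integral>\<^sup>+ x. ennreal (norm (c * norm (f x)) powr q) \<partial>M)
      = (\<integral>\<^sup>+ x. ennreal (c powr q) * ennreal (norm (f x) powr q) \<partial>M)"
    using c by (intro nn_integral_cong) (simp add: powr_mult abs_mult flip: ennreal_mult)
  also have "\<dots> = ennreal (c powr q) * (\<integral>\<^sup>+ x. ennreal (norm (f x) powr q) \<partial>M)"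
    by (rule nn_integral_cmult) measurable
  also have "\<dots> \<le> ennreal (c powr q) * ennreal (b powr q)"
    using Lp_norm_le_iff[OF p False b] le by (intro mult_left_mono) (auto simp: q_def)
  also have "\<dots> = ennreal ((c * b) powr q)"
    using b c by (simp add: powr_mult ennreal_mult)
  finally show ?thesis
    using b c by (subst Lp_norm_le_iff[OF p False]) (auto simp: q_def)
qed

text \<open>
  Minkowski's inequality by induction on the number of terms. The two types of values are independent
  because the later estimates dominate a norm in one of the three spaces by norms in the others.
\<close>

lemma Lp_norm_sum_le:
  fixes u :: "'i \<Rightarrow> 'a \<Rightarrow> 'b::real_normed_vector" and h :: "'a \<Rightarrow> 'c::real_normed_vector"
  assumes p: "1 \<le> p" and I: "finite I"
    and c: "\<And>i. i \<in> I \<Longrightarrow> 0 \<le> c i" and b: "\<And>i. i \<in> I \<Longrightarrow> 0 \<le> b i"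
    and mu: "\<And>i. i \<in> I \<Longrightarrow> (\<lambda>x. norm (u i x)) \<in> borel_measurable M"
    and mh: "(\<lambda>x. norm (h x)) \<in> borel_measurable M"
    and le: "\<And>i. i \<in> I \<Longrightarrow> Lp_norm p M (u i) \<le> ennreal (b i)"
    and h: "AE x in M. norm (h x) \<le> (\<Sum>i\<in>I. c i * norm (u i x))"
  shows "Lp_norm p M h \<le> ennreal (\<Sum>i\<in>I. c i * b i)"
proof -
  have sum: "Lp_norm p M (\<lambda>x. \<Sum>i\<in>J. c i * norm (u i x)) \<le> ennreal (\<Sum>i\<in>J. c i * b i)"
    if J: "finite J" "J \<subseteq> I" for J
    using J
  proof (induction J)
    case empty
    have "Lp_norm p M (\<lambda>x. 0 :: real) = 0"
      by (subst Lp_norm_eq_0[OF p]) auto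
    then show ?case by simp
  next
    case (insert i J)
    have m: "(\<lambda>x. \<Sum>i\<in>K. c i * norm (u i x)) \<in> borel_measurable M" if "K \<subseteq> I" for K
      by (intro borel_measurable_sum borel_measurable_times mu borel_measurable_const) (use that in auto)
    have "Lp_norm p M (\<lambda>x. \<Sum>i\<in>insert i J. c i * norm (u i x))
        \<le> Lp_norm p M (\<lambda>x. c i * norm (u i x)) + Lp_norm p M (\<lambda>x. \<Sum>i\<in>J. c i * norm (u i x))"
    proof (rule Lp_norm_triangle[OF p])
      show "(\<lambda>x. norm (c i * norm (u i x))) \<in> borel_measurable M"
        using mu[of i] insert by auto
      show "(\<lambda>x. norm (\<Sum>i\<in>J. c i * norm (u i x))) \<in> borel_measurable M"
        "(\<lambda>x. norm (\<Sum>i\<in>insert i J. c i * norm (u i x))) \<in> borel_measurable M"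
        using m[of J] m[of "insert i J"] insert by auto
      show "norm (\<Sum>i\<in>insert i J. c i * norm (u i x))
          \<le> norm (c i * norm (u i x)) + norm (\<Sum>i\<in>J. c i * norm (u i x))" for x
        using insert.hyps by (simp add: abs_triangle_ineq)
    qed
    also have "\<dots> \<le> ennreal (c i * b i) + ennreal (\<Sum>i\<in>J. c i * b i)"
      by (intro add_mono insert.IH Lp_norm_scale_le[OF p]) (use insert c b mu le in auto)
    also have "\<dots> = ennreal (\<Sum>i\<in>insert i J. c i * b i)"
      using insert c b by (subst ennreal_plus[symmetric]) (auto intro!: sum_nonneg)
    finally show ?case .
  qed
  have "Lp_norm p M h \<le> Lp_norm p M (\<lambda>x. \<Sum>i\<in>I. c i * norm (u i x))"
    by (rule Lp_norm_mono_AE[OF mh]) (use h in eventually_elim, auto)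
  then show ?thesis using sum[OF I order_refl] by (rule order_trans)
qed


section \<open>Cauchy sequences of simple functions\<close>

text \<open>
  A Borel--Cantelli argument. For finite \<open>p\<close> the functions \<open>(2\<^sup>k |d\<^sub>k|)\<^sup>p\<close> have summable integrals, so
  almost everywhere their sum is finite and its terms tend to zero.
\<close>

lemma AE_eventually_le_of_Lp_norm_le:
  fixes d :: "nat \<Rightarrow> 'a \<Rightarrow> 'b::real_normed_vector"
  assumes p: "1 \<le> p" and m[measurable]: "\<And>k. (\<lambda>x. norm (d k x)) \<in> borel_measurable M"
    and le: "\<And>k. Lp_norm p M (d k) \<le> ennreal ((1/4) ^ k)"
  shows "AE x in M. \<forall>\<^sub>F k in sequentially. norm (d k x) \<le> (1/2) ^ k"
proof (cases "p = \<infinity>")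
  case True
  have "AE x in M. norm (d k x) \<le> (1/2) ^ k" for k
  proof -
    have "(1/4::real) ^ k \<le> (1/2) ^ k" by (intro power_mono) auto
    then have "esssup M (\<lambda>x. ennreal (norm (d k x))) \<le> ennreal ((1/2) ^ k)"
      using le[of k] by (simp add: Lp_norm_def True) (meson ennreal_leI order_trans)
    then show ?thesis
      using esssup_AE[of "\<lambda>x. ennreal (norm (d k x))" M] by (auto elim!: eventually_mono dest: order_trans)
  qed
  then have "AE x in M. \<forall>k. norm (d k x) \<le> (1/2) ^ k"
    by (simp add: AE_all_countable)
  then show ?thesis by eventually_elim (rule always_eventually)
next
  case False
  define q where "q = enn2real p"
  have q: "1 \<le> q" using enn2real_ge_1[OF p False] by (simp add: q_def)
  define G where "G k x = (2 ^ k * norm (d k x)) powr q" for k x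
  have mG[measurable]: "G k \<in> borel_measurable M" for k
    unfolding G_def by measurable
  have IG: "(\<integral>\<^sup>+ x. ennreal (G k x) \<partial>M) \<le> ennreal ((1/2) ^ k)" for k
  proof -
    have "Lp_norm p M (\<lambda>x. 2 ^ k * norm (d k x)) \<le> ennreal (2 ^ k * (1/4) ^ k)"
      by (rule Lp_norm_scale_le[OF p _ _ m le]) auto
    then have "(\<integral>\<^sup>+ x. ennreal (G k x) \<partial>M) \<le> ennreal ((2 ^ k * (1/4) ^ k) powr q)"
      using Lp_norm_le_iff[OF p False, of "2 ^ k * (1/4) ^ k" M "\<lambda>x. 2 ^ k * norm (d k x)"]
      by (simp add: G_def q_def abs_mult)
    also have "(2 ^ k * (1/4) ^ k :: real) = (1/2) ^ k"
      by (simp flip: power_mult_distrib)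
    also have "((1/2::real) ^ k) powr q \<le> ((1/2) ^ k) powr 1"
      using q by (intro powr_mono') (auto intro: power_le_one)
    finally show ?thesis by (simp add: ennreal_leI)
  qed
  have "(\<integral>\<^sup>+ x. (\<Sum>k. ennreal (G k x)) \<partial>M) = (\<Sum>k. \<integral>\<^sup>+ x. ennreal (G k x) \<partial>M)"
    by (rule nn_integral_suminf) measurable
  also have "\<dots> \<le> (\<Sum>k. ennreal ((1/2) ^ k))"
    by (intro suminf_le IG) auto
  also have "\<dots> = ennreal (\<Sum>k. (1/2) ^ k)"
    by (rule suminf_ennreal2) auto
  finally have "(\<integral>\<^sup>+ x. (\<Sum>k. ennreal (G k x)) \<partial>M) \<noteq> \<infinity>"
    by (auto simp: top_unique)
  then have "AE x in M. (\<Sum>k. ennreal (G k x)) \<noteq> \<infinity>"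
    by (intro nn_integral_PInf_AE) measurable
  then show ?thesis
  proof eventually_elim
    case (elim x)
    then have "summable (\<lambda>k. G k x)"
      by (intro summable_suminf_not_top) (auto simp: G_def)
    then have "(\<lambda>k. G k x) \<longlonglongrightarrow> 0" by (rule summable_LIMSEQ_zero)
    then have "\<forall>\<^sub>F k in sequentially. G k x < 1" by (rule order_tendstoD) simp
    then show ?case
    proof eventually_elim
      case (elim k)
      have "2 ^ k * norm (d k x) \<le> 1"
      proof (rule ccontr)
        assume "\<not> ?thesis"
        then have "1 \<le> G k x" using q unfolding G_def by (intro ge_one_powr_ge_zero) auto
        then show False using elim by simp
      qed
      then show ?case by (simp add: power_one_over field_simps)
    qed
  qed
qed

text \<open>
  The Riesz--Fischer theorem along simple functions. Restricting to simple functions makes strong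
  measurability of the limit immediate: it is an almost everywhere limit of the given functions
  themselves. Fatou's lemma turns almost everywhere convergence of a subsequence into convergence in norm.
\<close>

lemma (in complete_measure) Lp_Cauchy_simple_convergent:
  fixes F :: "nat \<Rightarrow> 'a \<Rightarrow> 'b::banach"
  assumes p: "1 \<le> p" and simple: "\<And>n. simple_function M (F n)"
    and Cauchy: "\<And>e. 0 < e \<Longrightarrow> \<exists>K. \<forall>m\<ge>K. \<forall>n\<ge>K. Lp_norm p M (\<lambda>x. F m x - F n x) \<le> ennreal e"
  obtains g where "strongly_measurable M g"
    "\<And>e. 0 < e \<Longrightarrow> \<exists>K. \<forall>n\<ge>K. Lp_norm p M (\<lambda>x. F n x - g x) \<le> ennreal e"
proof -
  have "\<exists>K. \<forall>m\<ge>K. \<forall>n\<ge>K. Lp_norm p M (\<lambda>x. F m x - F n x) \<le> ennreal ((1/4) ^ k)" for k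
    by (rule Cauchy) simp
  then obtain K where K: "\<And>k m n. K k \<le> m \<Longrightarrow> K k \<le> n \<Longrightarrow> Lp_norm p M (\<lambda>x. F m x - F n x) \<le> ennreal ((1/4) ^ k)"
    by metis
  \<comment> \<open>indices past every threshold up to \<open>K k\<close>, and past \<open>k\<close> itself so that \<open>r\<close> tends to infinity\<close>
  define r where "r k = k + (\<Sum>l\<le>k. K l)" for k
  have r: "K k \<le> r k" "K k \<le> r (Suc k)" "k \<le> r k" for k
    using member_le_sum[of k "{..k}" K] by (auto simp: r_def)
  have sm: "strongly_measurable M (F n)" for n
    unfolding strongly_measurable_def using simple by (intro exI[of _ "\<lambda>_. F n"]) auto
  have "AE x in M. \<forall>\<^sub>F k in sequentially. norm (F (r (Suc k)) x - F (r k) x) \<le> (1/2) ^ k"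
    by (rule AE_eventually_le_of_Lp_norm_le[OF p strongly_measurable_norm[OF strongly_measurable_diff[OF sm sm]] K[OF r(2) r(1)]])
  then have lim: "AE x in M. (\<lambda>k. F (r k) x) \<longlonglongrightarrow> lim (\<lambda>k. F (r k) x)"
  proof eventually_elim
    case (elim x)
    have "summable (\<lambda>k. F (r (Suc k)) x - F (r k) x)"
      by (rule summable_comparison_test_ev[OF elim]) (rule summable_geometric, simp)
    then have "convergent (\<lambda>n. \<Sum>k<n. F (r (Suc k)) x - F (r k) x)"
      by (simp add: summable_iff_convergent)
    then have "convergent (\<lambda>n. F (r n) x - F (r 0) x)"
      by (simp only: sum_lessThan_telescope[of "\<lambda>k. F (r k) x"])
    then show ?case
      by (simp add: convergent_LIMSEQ_iff[symmetric] convergent_diff_const_right_iff)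
  qed
  define g where "g x = lim (\<lambda>k. F (r k) x)" for x
  have lim: "AE x in M. (\<lambda>k. F (r k) x) \<longlonglongrightarrow> g x" using lim by (simp add: g_def)
  have smg: "strongly_measurable M g"
    unfolding strongly_measurable_def using simple lim by (intro exI[of _ "\<lambda>k. F (r k)"]) auto
  have "\<exists>K. \<forall>n\<ge>K. Lp_norm p M (\<lambda>x. F n x - g x) \<le> ennreal e" if e: "0 < e" for e
  proof -
    obtain K where K: "\<And>m n. K \<le> m \<Longrightarrow> K \<le> n \<Longrightarrow> Lp_norm p M (\<lambda>x. F m x - F n x) \<le> ennreal e"
      using Cauchy[OF e] by blast
    have "Lp_norm p M (\<lambda>x. F n x - g x) \<le> ennreal e" if n: "K \<le> n" for n
    proof -
      have le: "Lp_norm p M (\<lambda>x. F n x - F (r (k + K)) x) \<le> ennreal e" for k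
        using K[OF n, of "r (k + K)"] r(3)[of "k + K"] by simp
      have lim': "AE x in M. (\<lambda>k. norm (F n x - F (r (k + K)) x)) \<longlonglongrightarrow> norm (F n x - g x)"
        using lim
      proof eventually_elim
        case (elim x)
        show ?case
          by (intro tendsto_norm tendsto_diff tendsto_const LIMSEQ_ignore_initial_segment[OF elim])
      qed
      have mk[measurable]: "(\<lambda>x. norm (F n x - F k x)) \<in> borel_measurable M" for k
        by (rule strongly_measurable_norm[OF strongly_measurable_diff[OF sm sm]])
      have mg[measurable]: "(\<lambda>x. norm (F n x - g x)) \<in> borel_measurable M"
        by (rule strongly_measurable_norm[OF strongly_measurable_diff[OF sm smg]])
      show ?thesis
      proof (cases "p = \<infinity>")
        case True
        have "AE x in M. \<forall>k. norm (F n x - F (r (k + K)) x) \<le> e"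
          unfolding AE_all_countable
        proof
          fix k
          have "esssup M (\<lambda>x. ennreal (norm (F n x - F (r (k + K)) x))) \<le> ennreal e"
            using le[of k] by (simp add: Lp_norm_def True)
          then have "AE x in M. ennreal (norm (F n x - F (r (k + K)) x)) \<le> ennreal e"
            using esssup_AE[of "\<lambda>x. ennreal (norm (F n x - F (r (k + K)) x))" M]
            by (auto elim!: eventually_mono)
          then show "AE x in M. norm (F n x - F (r (k + K)) x) \<le> e"
            by (rule eventually_mono) (use e in simp)
        qed
        then have "AE x in M. ennreal (norm (F n x - g x)) \<le> ennreal e"
          using lim'
        proof eventually_elim
          case (elim x)
          show ?case by (rule ennreal_leI, rule LIMSEQ_le_const2[OF elim(2)]) (use elim(1) in auto)
        qed
        then have "esssup M (\<lambda>x. ennreal (norm (F n x - g x))) \<le> ennreal e"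
          by (intro esssup_I) measurable
        then show ?thesis by (simp add: Lp_norm_def True)
      next
        case False
        define q where "q = enn2real p"
        have q: "1 \<le> q" using enn2real_ge_1[OF p False] by (simp add: q_def)
        have "(\<integral>\<^sup>+ x. ennreal (norm (F n x - g x) powr q) \<partial>M)
            = (\<integral>\<^sup>+ x. liminf (\<lambda>k. ennreal (norm (F n x - F (r (k + K)) x) powr q)) \<partial>M)"
        proof (rule nn_integral_cong_AE, use lim' in eventually_elim)
          case (elim x)
          have "(\<lambda>k. ennreal (norm (F n x - F (r (k + K)) x) powr q)) \<longlonglongrightarrow> ennreal (norm (F n x - g x) powr q)"
            using q by (intro tendsto_ennrealI tendsto_powr2[OF elim tendsto_const]) auto
          then show ?case by (rule lim_imp_Liminf[OF sequentially_bot, symmetric])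
        qed
        also have "\<dots> \<le> liminf (\<lambda>k. \<integral>\<^sup>+ x. ennreal (norm (F n x - F (r (k + K)) x) powr q) \<partial>M)"
          by (rule nn_integral_liminf) measurable
        also have "\<dots> \<le> liminf (\<lambda>k. ennreal (e powr q))"
        proof (intro Liminf_mono always_eventually allI)
          show "(\<integral>\<^sup>+ x. ennreal (norm (F n x - F (r (k + K)) x) powr q) \<partial>M) \<le> ennreal (e powr q)" for k
            using le[of k] e Lp_norm_le_iff[OF p False, of e M "\<lambda>x. F n x - F (r (k + K)) x"]
            by (simp add: q_def)
        qed
        also have "\<dots> = ennreal (e powr q)" by (simp add: Liminf_const)
        finally show ?thesis
          using Lp_norm_le_iff[OF p False, of e M "\<lambda>x. F n x - g x"] e by (simp add: q_def)
      qed
    qed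
    then show ?thesis by blast
  qed
  then show thesis using smg that by blast
qed

text \<open>
  Completeness is asked of Cauchy sequences inside the set itself, so that the preceding theorem applies
  to a set of classes of simple functions.
\<close>

lemma (in Metric_space) compactin_closure_of_totally_bounded:
  assumes S: "mtotally_bounded S"
    and complete: "\<And>\<sigma>. range \<sigma> \<subseteq> S \<Longrightarrow> MCauchy \<sigma> \<Longrightarrow> \<exists>l. limitin mtopology \<sigma> l sequentially"
  shows "compactin mtopology (mtopology closure_of S)"
proof -
  have SM: "S \<subseteq> M" using S by (rule mtotally_bounded_imp_subset)
  have "\<exists>l r. l \<in> M \<and> strict_mono r \<and> limitin mtopology (\<sigma> \<circ> r) l sequentially"
    if \<sigma>: "range \<sigma> \<subseteq> S" for \<sigma> :: "nat \<Rightarrow> 'a"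
  proof -
    obtain r where r: "strict_mono r" "MCauchy (\<sigma> \<circ> r)"
      using S \<sigma> unfolding mtotally_bounded_sequentially by blast
    moreover have "range (\<sigma> \<circ> r) \<subseteq> S" using \<sigma> by auto
    ultimately obtain l where "limitin mtopology (\<sigma> \<circ> r) l sequentially"
      using complete by blast
    then show ?thesis using r(1) limitin_mspace by blast
  qed
  then have "\<forall>U. U \<subseteq> S \<and> infinite U \<longrightarrow> M \<inter> mtopology derived_set_of U \<noteq> {}"
    using Bolzano_Weierstrass_property[OF SM SM] by blast
  then show ?thesis
    unfolding compact_closure_of_eq_Bolzano_Weierstrass by blast
qed


section \<open>Functions that are constant on the cells of a uniform grid\<close>

definition grid_norm :: "ennreal \<Rightarrow> real \<Rightarrow> nat \<Rightarrow> (nat \<Rightarrow> 'a::real_normed_vector) \<Rightarrow> ennreal" where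
  "grid_norm p T N v = Lp_norm p (lebesgue_on {0<..<T}) (piecewise_const (T / real N) v)"

definition grid_index :: "real \<Rightarrow> nat \<Rightarrow> real \<Rightarrow> nat" where
  "grid_index T N t = nat \<lceil>t / (T / real N)\<rceil>"

lemma piecewise_const_grid_index: "piecewise_const (T / real N) v t = v (grid_index T N t)"
  by (simp add: piecewise_const_def grid_index_def)

lemma grid_index_bounds:
  assumes "0 < T" "1 \<le> N" "0 < t" "t < T"
  shows "grid_index T N t \<in> {1..N}"
    and "real (grid_index T N t) - 1 < t * real N / T" "t * real N / T \<le> real (grid_index T N t)"
proof -
  have eq: "t / (T / real N) = t * real N / T" by simp
  have pos: "0 < t * real N / T" using assms by simp
  have "t * real N / T < real N" using assms by (simp add: field_simps)
  then have "\<lceil>t * real N / T\<rceil> \<le> int N" by (simp add: ceiling_le_iff)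
  moreover have one: "1 \<le> \<lceil>t * real N / T\<rceil>" using pos by linarith
  ultimately show "grid_index T N t \<in> {1..N}"
    by (auto simp: grid_index_def eq le_nat_iff nat_le_iff)
  have "real (grid_index T N t) = of_int \<lceil>t * real N / T\<rceil>"
    unfolding grid_index_def eq using one by (subst of_nat_nat) auto
  then show "real (grid_index T N t) - 1 < t * real N / T" "t * real N / T \<le> real (grid_index T N t)"
    by linarith+
qed

lemma grid_index_measurable: "grid_index T N \<in> measurable borel (count_space UNIV)"
  unfolding grid_index_def by measurable

lemma grid_index_measurable_lebesgue_on:
  "grid_index T N \<in> measurable (lebesgue_on {0<..<T}) (count_space UNIV)"
proof -
  have "grid_index T N \<in> measurable lebesgue (count_space UNIV)"
    using grid_index_measurable by (intro measurable_completion) simp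
  then show ?thesis by (rule measurable_restrict_space1)
qed

lemma emeasure_grid_cell:
  assumes "0 < T" "1 \<le> N" "k \<in> {1..N}"
  shows "emeasure (lebesgue_on {0<..<T}) (grid_index T N -` {k} \<inter> {0<..<T}) = ennreal (T / real N)"
proof -
  define \<tau> where "\<tau> = T / real N"
  have \<tau>: "0 < \<tau>" "T = real N * \<tau>" using assms by (auto simp: \<tau>_def)
  have idx: "grid_index T N t = k \<longleftrightarrow> real (k - 1) * \<tau> < t \<and> t \<le> real k * \<tau>" if "0 < t" for t
  proof -
    have "0 < \<lceil>t / \<tau>\<rceil>" using that \<tau> by simp
    then have "grid_index T N t = k \<longleftrightarrow> \<lceil>t / \<tau>\<rceil> = int k"
      by (auto simp: grid_index_def \<tau>_def)
    also have "\<dots> \<longleftrightarrow> real k - 1 < t / \<tau> \<and> t / \<tau> \<le> real k"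
      by (simp add: ceiling_eq_iff)
    also have "\<dots> \<longleftrightarrow> real (k - 1) * \<tau> < t \<and> t \<le> real k * \<tau>"
      using \<tau> assms(3) by (simp add: pos_less_divide_eq pos_divide_le_eq of_nat_diff)
    finally show ?thesis .
  qed
  have kT: "real k * \<tau> \<le> T" using assms \<tau> by (auto intro!: mult_right_mono)
  have lo: "0 \<le> real (k - 1) * \<tau>" using \<tau> by simp
  have sub: "{real (k - 1) * \<tau><..<real k * \<tau>} \<subseteq> grid_index T N -` {k} \<inter> {0<..<T}"
    "grid_index T N -` {k} \<inter> {0<..<T} \<subseteq> {real (k - 1) * \<tau>..real k * \<tau>}"
    using idx kT lo by (auto simp: vimage_def intro: less_imp_le dest: order.strict_trans1) (use idx in fastforce)+
  have sets: "grid_index T N -` {k} \<inter> {0<..<T} \<in> sets lebesgue"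
  proof -
    have "grid_index T N -` {k} \<inter> space borel \<in> sets borel"
      by (rule measurable_sets[OF grid_index_measurable]) auto
    then show ?thesis by auto
  qed
  have len: "real k * \<tau> - real (k - 1) * \<tau> = \<tau>"
    using assms(3) by (simp add: of_nat_diff algebra_simps)
  have le: "real (k - 1) * \<tau> \<le> real k * \<tau>" using len \<tau> by linarith
  have "emeasure (lebesgue_on {0<..<T}) (grid_index T N -` {k} \<inter> {0<..<T})
      = emeasure lebesgue (grid_index T N -` {k} \<inter> {0<..<T})"
    by (rule emeasure_restrict_space) auto
  also have "\<dots> = ennreal \<tau>"
  proof (rule antisym)
    show "emeasure lebesgue (grid_index T N -` {k} \<inter> {0<..<T}) \<le> ennreal \<tau>"
      using emeasure_mono[OF sub(2), of lebesgue] le len by simp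
    show "ennreal \<tau> \<le> emeasure lebesgue (grid_index T N -` {k} \<inter> {0<..<T})"
      using emeasure_mono[OF sub(1) sets] le len by simp
  qed
  finally show ?thesis by (simp add: \<tau>_def)
qed

text \<open>
  Pushing Lebesgue measure forward to the cell numbers turns integrals and almost everywhere
  statements about functions on the grid into finite sums and finite conjunctions.
\<close>

lemma distr_grid_index:
  assumes "0 < T" "1 \<le> N"
  shows "distr (lebesgue_on {0<..<T}) (count_space UNIV) (grid_index T N)
       = point_measure UNIV (\<lambda>k. ennreal (T / real N) * indicator {1..N} k)"
    (is "?D = ?P")
proof (rule measure_eqI_countable[where A = UNIV])
  fix k
  have "emeasure ?D {k} = emeasure (lebesgue_on {0<..<T}) (grid_index T N -` {k} \<inter> {0<..<T})"
    by (subst emeasure_distr[OF grid_index_measurable_lebesgue_on]) auto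
  also have "\<dots> = ennreal (T / real N) * indicator {1..N} k"
  proof (cases "k \<in> {1..N}")
    case True
    then show ?thesis using emeasure_grid_cell[OF assms] by simp
  next
    case False
    then have "grid_index T N -` {k} \<inter> {0<..<T} = {}"
      using grid_index_bounds(1)[OF assms] by fastforce
    then show ?thesis using False by simp
  qed
  also have "\<dots> = (\<Sum>a\<in>{k}. ennreal (T / real N) * indicator {1..N} a)"
    by (subst sum.insert) auto
  also have "\<dots> = emeasure ?P {k}"
    by (rule emeasure_point_measure_finite2[symmetric]) auto
  finally show "emeasure ?D {k} = emeasure ?P {k}" .
qed (auto simp: point_measure_def)

lemma nn_integral_grid:
  assumes "0 < T" "1 \<le> N"
  shows "(\<integral>\<^sup>+ t. g (grid_index T N t) \<partial>lebesgue_on {0<..<T}) = ennreal (T / real N) * (\<Sum>k = 1..N. g k)"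
proof -
  have "(\<integral>\<^sup>+ t. g (grid_index T N t) \<partial>lebesgue_on {0<..<T})
      = (\<integral>\<^sup>+ k. g k \<partial>point_measure UNIV (\<lambda>k. ennreal (T / real N) * indicator {1..N} k))"
    unfolding distr_grid_index[OF assms, symmetric]
    by (rule nn_integral_distr[symmetric]) (use grid_index_measurable_lebesgue_on in auto)
  also have "\<dots> = (\<integral>\<^sup>+ k. ennreal (T / real N) * g k * indicator {1..N} k \<partial>count_space UNIV)"
    unfolding point_measure_def by (subst nn_integral_density) (auto simp: mult_ac)
  also have "\<dots> = (\<Sum>k = 1..N. ennreal (T / real N) * g k)"
    by (subst nn_integral_count_space_indicator[symmetric])
       (auto simp: nn_integral_count_space_finite)
  finally show ?thesis by (simp add: sum_distrib_left)
qed

lemma AE_grid_index: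
  assumes "0 < T" "1 \<le> N"
  shows "(AE t in lebesgue_on {0<..<T}. P (grid_index T N t)) \<longleftrightarrow> (\<forall>k\<in>{1..N}. P k)"
proof
  assume AE: "AE t in lebesgue_on {0<..<T}. P (grid_index T N t)"
  have "AE k in point_measure UNIV (\<lambda>k. ennreal (T / real N) * indicator {1..N} k). P k"
    unfolding distr_grid_index[OF assms, symmetric]
    by (subst AE_distr_iff) (use AE grid_index_measurable_lebesgue_on in auto)
  then show "\<forall>k\<in>{1..N}. P k"
    using assms by (simp add: AE_point_measure ennreal_zero_less_mult_iff)
next
  assume *: "\<forall>k\<in>{1..N}. P k"
  show "AE t in lebesgue_on {0<..<T}. P (grid_index T N t)"
    by (rule AE_I2) (use * grid_index_bounds(1)[OF assms] in auto)
qed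

lemma measurable_piecewise_const:
  fixes g :: "'a \<Rightarrow> 'b::topological_space"
  shows "(\<lambda>t. g (piecewise_const (T / real N) v t)) \<in> borel_measurable (lebesgue_on {0<..<T})"
  unfolding piecewise_const_grid_index
  by (rule measurable_compose[OF grid_index_measurable_lebesgue_on]) simp

lemma measurable_two_grids:
  fixes g :: "'a \<Rightarrow> 'b \<Rightarrow> 'c::topological_space"
  shows "(\<lambda>t. g (piecewise_const (T / real N) v t) (piecewise_const (T / real M) w t))
    \<in> borel_measurable (lebesgue_on {0<..<T})"
proof -
  have "(\<lambda>t. (\<lambda>k. g (v (fst k)) (w (snd k))) (grid_index T N t, grid_index T M t))
      \<in> borel_measurable (lebesgue_on {0<..<T})"
    by (rule measurable_compose[OF measurable_Pair[OF grid_index_measurable_lebesgue_on grid_index_measurable_lebesgue_on]])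
       (simp add: pair_measure_countable[OF countableI_type countableI_type])
  then show ?thesis by (simp add: piecewise_const_grid_index)
qed

lemma simple_function_piecewise_const:
  assumes "0 < T" "1 \<le> N"
  shows "simple_function (lebesgue_on {0<..<T}) (\<lambda>t. g (piecewise_const (T / real N) v t))"
proof -
  have sf: "simple_function (lebesgue_on {0<..<T}) (grid_index T N)"
    unfolding simple_function_def
  proof (intro conjI ballI)
    have "grid_index T N ` space (lebesgue_on {0<..<T}) \<subseteq> {1..N}"
      using grid_index_bounds(1)[OF assms] by auto
    then show "finite (grid_index T N ` space (lebesgue_on {0<..<T}))"
      by (rule finite_subset) simp
    show "grid_index T N -` {k} \<inter> space (lebesgue_on {0<..<T}) \<in> sets (lebesgue_on {0<..<T})" for k
      by (rule measurable_sets[OF grid_index_measurable_lebesgue_on]) simp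
  qed
  show ?thesis
    unfolding piecewise_const_grid_index by (rule simple_function_compose1[OF sf])
qed

lemma simple_function_strongly_measurable:
  assumes "simple_function M f"
  shows "strongly_measurable M f"
  unfolding strongly_measurable_def using assms by (intro exI[of _ "\<lambda>_. f"]) auto

lemma grid_norm_le_iff:
  assumes "0 < T" "1 \<le> N" "1 \<le> p" "0 \<le> b"
  shows "grid_norm p T N v \<le> ennreal b \<longleftrightarrow>
    (if p = \<infinity> then \<forall>k\<in>{1..N}. norm (v k) \<le> b
     else (T / real N) * (\<Sum>k = 1..N. norm (v k) powr enn2real p) \<le> b powr enn2real p)"
proof (cases "p = \<infinity>")
  case True
  let ?f = "\<lambda>t. ennreal (norm (v (grid_index T N t)))"
  have m: "?f \<in> borel_measurable (lebesgue_on {0<..<T})"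
    by (rule measurable_compose[OF grid_index_measurable_lebesgue_on]) simp
  have "esssup (lebesgue_on {0<..<T}) ?f \<le> ennreal b \<longleftrightarrow> (AE t in lebesgue_on {0<..<T}. ?f t \<le> ennreal b)"
    using esssup_AE[of ?f "lebesgue_on {0<..<T}"] esssup_I[OF m] by (fastforce elim: eventually_mono)
  also have "\<dots> \<longleftrightarrow> (\<forall>k\<in>{1..N}. norm (v k) \<le> b)"
    using AE_grid_index[OF assms(1,2), of "\<lambda>k. ennreal (norm (v k)) \<le> ennreal b"] assms(4) by simp
  finally show ?thesis
    using True by (simp add: grid_norm_def Lp_norm_def piecewise_const_grid_index)
next
  case False
  have "grid_norm p T N v \<le> ennreal b \<longleftrightarrow>
    ennreal (T / real N) * (\<Sum>k = 1..N. ennreal (norm (v k) powr enn2real p)) \<le> ennreal (b powr enn2real p)"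
    unfolding grid_norm_def
    by (subst Lp_norm_le_iff[OF assms(3) False assms(4)])
       (simp add: piecewise_const_grid_index nn_integral_grid[OF assms(1,2), of "\<lambda>k. ennreal (norm (v k) powr enn2real p)"])
  also have "ennreal (T / real N) * (\<Sum>k = 1..N. ennreal (norm (v k) powr enn2real p))
      = ennreal ((T / real N) * (\<Sum>k = 1..N. norm (v k) powr enn2real p))"
    using assms(1) by (subst ennreal_mult) (auto simp: sum_nonneg sum_ennreal)
  finally show ?thesis using False by simp
qed

lemma grid_norm_sum_le:
  fixes u :: "'i \<Rightarrow> nat \<Rightarrow> 'b::real_normed_vector" and h :: "nat \<Rightarrow> 'c::real_normed_vector"
  assumes "0 < T" "1 \<le> N" "1 \<le> p" "finite I"
    and "\<And>i. i \<in> I \<Longrightarrow> 0 \<le> c i" "\<And>i. i \<in> I \<Longrightarrow> 0 \<le> b i"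
    and "\<And>i. i \<in> I \<Longrightarrow> grid_norm p T N (u i) \<le> ennreal (b i)"
    and "\<And>k. k \<in> {1..N} \<Longrightarrow> norm (h k) \<le> (\<Sum>i\<in>I. c i * norm (u i k))"
  shows "grid_norm p T N h \<le> ennreal (\<Sum>i\<in>I. c i * b i)"
  unfolding grid_norm_def
proof (rule Lp_norm_sum_le[where u = "\<lambda>i. piecewise_const (T / real N) (u i)"])
  show "AE t in lebesgue_on {0<..<T}. norm (piecewise_const (T / real N) h t)
      \<le> (\<Sum>i\<in>I. c i * norm (piecewise_const (T / real N) (u i) t))"
    unfolding piecewise_const_grid_index
    using AE_grid_index[OF assms(1,2), of "\<lambda>k. norm (h k) \<le> (\<Sum>i\<in>I. c i * norm (u i k))"] assms(8)
    by simp
qed (use assms measurable_piecewise_const[of norm] in \<open>auto simp: grid_norm_def\<close>)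

text \<open>
  All cells have the same length, so the norm only sees the values with multiplicity. This replaces
  translation invariance of Lebesgue measure: a shifted grid function, cut off where the shift leaves
  the grid, is an injective reindexing of the original one.
\<close>

lemma grid_norm_reindex_le:
  fixes v :: "nat \<Rightarrow> 'b::real_normed_vector" and w :: "nat \<Rightarrow> 'c::real_normed_vector"
  assumes "0 < T" "1 \<le> N" "1 \<le> p" "0 \<le> b"
    and K: "K \<subseteq> {1..N}" and inj: "inj_on \<sigma> K" and im: "\<sigma> ` K \<subseteq> {1..N}"
    and le: "\<And>k. k \<in> K \<Longrightarrow> norm (w k) \<le> norm (v (\<sigma> k))"
    and zero: "\<And>k. k \<in> {1..N} - K \<Longrightarrow> w k = 0"
    and b: "grid_norm p T N v \<le> ennreal b"
  shows "grid_norm p T N w \<le> ennreal b"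
proof (cases "p = \<infinity>")
  case True
  have v: "\<forall>k\<in>{1..N}. norm (v k) \<le> b"
    using b grid_norm_le_iff[OF assms(1-4), of v] True by simp
  have "norm (w k) \<le> b" if "k \<in> {1..N}" for k
  proof (cases "k \<in> K")
    case True
    then show ?thesis using le[OF True] v im by force
  next
    case False
    then show ?thesis using zero[of k] that assms(4) by simp
  qed
  then show ?thesis using grid_norm_le_iff[OF assms(1-4), of w] True by simp
next
  case False
  define q where "q = enn2real p"
  have q: "1 \<le> q" using enn2real_ge_1[OF assms(3) False] by (simp add: q_def)
  have "(\<Sum>k = 1..N. norm (w k) powr q) = (\<Sum>k\<in>K. norm (w k) powr q)"
    using K zero by (intro sum.mono_neutral_right) auto
  also have "\<dots> \<le> (\<Sum>k\<in>K. norm (v (\<sigma> k)) powr q)"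
    using le q by (intro sum_mono powr_mono2) auto
  also have "\<dots> = (\<Sum>k\<in>\<sigma> ` K. norm (v k) powr q)"
    by (simp add: sum.reindex[OF inj])
  also have "\<dots> \<le> (\<Sum>k = 1..N. norm (v k) powr q)"
    using im by (intro sum_mono2) auto
  finally have "(T / real N) * (\<Sum>k = 1..N. norm (w k) powr q) \<le> (T / real N) * (\<Sum>k = 1..N. norm (v k) powr q)"
    using assms(1) by (intro mult_left_mono) auto
  also have "\<dots> \<le> b powr q"
    using b grid_norm_le_iff[OF assms(1-4), of v] False by (simp add: q_def)
  finally show ?thesis
    using grid_norm_le_iff[OF assms(1-4), of w] False by (simp add: q_def)
qed

text \<open>
  A crude substitute for Hoelder's inequality: \<open>x \<le> 1 + x\<^sup>q\<close> for \<open>x \<ge> 0\<close> and \<open>q \<ge> 1\<close>. It bounds single values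
  and averages of values, with a constant that may depend on the grid but not on the function.
\<close>

lemma grid_norm_partial_sum_le:
  assumes T: "0 < T" "1 \<le> N" "1 \<le> p" and B: "0 \<le> B"
    and v: "grid_norm p T N v \<le> ennreal B" and K: "K \<subseteq> {1..N}"
  shows "(\<Sum>k\<in>K. norm (v k)) \<le> (1 + B + B powr enn2real p) * (real (card K) + real N / T)"
proof -
  define q where "q = enn2real p"
  have finK: "finite K" using K finite_subset by blast
  have NT: "0 \<le> real N / T" using T by simp
  show ?thesis
  proof (cases "p = \<infinity>")
    case True
    have "(\<Sum>k\<in>K. norm (v k)) \<le> (\<Sum>k\<in>K. B)"
      using v K grid_norm_le_iff[OF T B, of v] True by (intro sum_mono) auto
    also have "\<dots> = B * real (card K)" by simp
    also have "\<dots> \<le> (1 + B + B powr enn2real p) * (real (card K) + real N / T)"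
      using B NT by (intro mult_mono) auto
    finally show ?thesis .
  next
    case False
    have q: "1 \<le> q" using enn2real_ge_1[OF T(3) False] by (simp add: q_def)
    have pt: "x \<le> 1 + x powr q" if "0 \<le> x" for x :: real
    proof (cases "x \<le> 1")
      case True
      then show ?thesis using powr_ge_zero[of x q] by linarith
    next
      case False
      then have "x powr 1 \<le> x powr q" using q by (intro powr_mono) auto
      then show ?thesis using False by simp
    qed
    have "T / real N * (\<Sum>k = 1..N. norm (v k) powr q) \<le> B powr q"
      using v grid_norm_le_iff[OF T B, of v] False by (simp add: q_def)
    then have le: "(\<Sum>k = 1..N. norm (v k) powr q) \<le> B powr q * (real N / T)"
      using T by (simp add: field_simps)
    have "(\<Sum>k\<in>K. norm (v k)) \<le> (\<Sum>k\<in>K. 1 + norm (v k) powr q)"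
      by (intro sum_mono pt) auto
    also have "\<dots> = real (card K) + (\<Sum>k\<in>K. norm (v k) powr q)" by (simp add: sum.distrib)
    also have "(\<Sum>k\<in>K. norm (v k) powr q) \<le> (\<Sum>k = 1..N. norm (v k) powr q)"
      using K by (intro sum_mono2) auto
    also note le
    also have "real (card K) + B powr q * (real N / T) \<le> (1 + B + B powr q) * real (card K) + (1 + B + B powr q) * (real N / T)"
      using B NT mult_right_mono[of 1 "1 + B + B powr q" "real (card K)"]
        mult_right_mono[of "B powr q" "1 + B + B powr q" "real N / T"] powr_ge_zero[of B q] by linarith
    finally show ?thesis by (simp add: q_def distrib_left)
  qed
qed

lemma grid_norm_le_sup:
  assumes T: "0 < T" "1 \<le> N" "1 \<le> p" and b: "0 \<le> b" and v: "\<And>k. k \<in> {1..N} \<Longrightarrow> norm (v k) \<le> b"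
  shows "grid_norm p T N v \<le> ennreal (b * (1 + T))"
proof -
  have b': "0 \<le> b * (1 + T)" "b \<le> b * (1 + T)" using b T by (auto simp: algebra_simps)
  show ?thesis
  proof (cases "p = \<infinity>")
    case True
    then show ?thesis using grid_norm_le_iff[OF T b'(1), of v] v b' by force
  next
    case False
    define q where "q = enn2real p"
    have q: "1 \<le> q" using enn2real_ge_1[OF T(3) False] by (simp add: q_def)
    have "T / real N * (\<Sum>k = 1..N. norm (v k) powr q) \<le> T / real N * (\<Sum>k = 1..N. b powr q)"
      using v T q by (intro mult_left_mono sum_mono powr_mono2) auto
    also have "\<dots> = T * b powr q" using T by simp
    also have "\<dots> \<le> (1 + T) powr q * b powr q"
    proof (intro mult_right_mono)
      have "(1 + T) powr 1 \<le> (1 + T) powr q" using q T by (intro powr_mono) auto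
      then show "T \<le> (1 + T) powr q" using T by simp
    qed auto
    also have "\<dots> = (b * (1 + T)) powr q" using b T by (simp add: powr_mult mult.commute)
    finally show ?thesis using grid_norm_le_iff[OF T b'(1), of v] False by (simp add: q_def)
  qed
qed


section \<open>The discrete Caputo derivative controls shifts\<close>

text \<open>
  The defining recursion of the weights says precisely that this convolution does not change from \<open>k\<close>
  to \<open>k + 1\<close>.
\<close>

lemma caputo_weight_convolution:
  assumes "1 \<le> k"
  shows "(\<Sum>j = 1..k. real (k - j + 1) powr (\<alpha> - 1) * caputo_weight \<alpha> j) = 1"
  using assms
proof (induction k rule: dec_induct)
  case base
  show ?case by simp
next
  case (step k)
  obtain m where m: "k = Suc m" using step by (cases k) auto
  have "caputo_weight \<alpha> (Suc k)
      = (\<Sum>j = 1..k. (real (k - j + 1) powr (\<alpha> - 1) - real (k - j + 2) powr (\<alpha> - 1)) * caputo_weight \<alpha> j)"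
    unfolding m by (simp only: caputo_weight.simps Let_def)
  also have "\<dots> = 1 - (\<Sum>j = 1..k. real (k - j + 2) powr (\<alpha> - 1) * caputo_weight \<alpha> j)"
    using step.IH by (simp only: left_diff_distrib sum_subtractf)
  finally have "caputo_weight \<alpha> (Suc k)
      = 1 - (\<Sum>j = 1..k. real (k - j + 2) powr (\<alpha> - 1) * caputo_weight \<alpha> j)" .
  moreover have "(\<Sum>j = 1..k. real (Suc k - j + 1) powr (\<alpha> - 1) * caputo_weight \<alpha> j)
      = (\<Sum>j = 1..k. real (k - j + 2) powr (\<alpha> - 1) * caputo_weight \<alpha> j)"
    by (intro sum.cong) (auto simp: Suc_diff_le)
  ultimately show ?case by simp
qed

text \<open>
  The discrete derivative is the convolution of the weights with the increments of \<open>v\<close>. Convolving once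
  more with \<open>r\<^sup>\<alpha>\<^sup>-\<^sup>1\<close> gives every increment the total weight one, by the previous lemma, and the increments
  telescope.
\<close>

lemma discrete_caputo_inversion:
  fixes v :: "nat \<Rightarrow> 'a::real_normed_vector"
  shows "(\<Sum>k = 1..m. real (m - k + 1) powr (\<alpha> - 1) *\<^sub>R discrete_caputo \<alpha> \<tau> v k)
       = (Gamma \<alpha> * \<tau> powr (- \<alpha>)) *\<^sub>R (v m - v 0)"
proof -
  define a where "a r = real r powr (\<alpha> - 1)" for r :: nat
  define c where "c = Gamma \<alpha> * \<tau> powr (- \<alpha>)"
  define w where "w = caputo_weight \<alpha>"
  have inner: "(\<Sum>k = Suc j..m. a (m - k + 1) * w (k - j)) = 1" if "j < m" for j
  proof -
    have "(\<Sum>k = Suc j..m. a (m - k + 1) * w (k - j)) = (\<Sum>k = 1 + j..(m - j) + j. a (m - k + 1) * w (k - j))"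
      using that by simp
    also have "\<dots> = (\<Sum>l = 1..m - j. a (m - (l + j) + 1) * w (l + j - j))"
      by (rule sum.shift_bounds_cl_nat_ivl)
    also have "\<dots> = (\<Sum>l = 1..m - j. a (m - j - l + 1) * w l)"
      by (intro sum.cong) (auto simp: add.commute)
    also have "\<dots> = 1"
      unfolding a_def w_def by (rule caputo_weight_convolution) (use that in auto)
    finally show ?thesis .
  qed
  have "(\<Sum>k = 1..m. a (m - k + 1) *\<^sub>R discrete_caputo \<alpha> \<tau> v k)
      = (\<Sum>k = 1..m. \<Sum>j<k. c *\<^sub>R ((a (m - k + 1) * w (k - j)) *\<^sub>R (v (Suc j) - v j)))"
    by (simp add: discrete_caputo_def c_def w_def scaleR_sum_right mult_ac)
  also have "\<dots> = (\<Sum>k\<le>m. \<Sum>j<k. c *\<^sub>R ((a (m - k + 1) * w (k - j)) *\<^sub>R (v (Suc j) - v j)))"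
    by (intro sum.mono_neutral_left) (auto simp: Suc_le_eq)
  also have "\<dots> = (\<Sum>j<m. \<Sum>k = Suc j..m. c *\<^sub>R ((a (m - k + 1) * w (k - j)) *\<^sub>R (v (Suc j) - v j)))"
    by (rule sum.nested_swap')
  also have "\<dots> = (\<Sum>j<m. c *\<^sub>R (v (Suc j) - v j))"
    using inner by (intro sum.cong refl)
      (simp add: scaleR_sum_left[symmetric] scaleR_sum_right[symmetric] sum_distrib_left[symmetric])
  also have "\<dots> = c *\<^sub>R (v m - v 0)"
    by (simp only: scaleR_sum_right[symmetric] sum_lessThan_telescope)
  finally show ?thesis by (simp add: a_def c_def)
qed

text \<open>
  Comparison with the integral of \<open>x\<^sup>\<alpha>\<^sup>-\<^sup>1\<close>, one step at a time by the mean value theorem.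
\<close>

lemma sum_powr_le:
  fixes \<alpha> :: real
  assumes "0 < \<alpha>" "\<alpha> \<le> 1"
  shows "(\<Sum>i = 1..d. real i powr (\<alpha> - 1)) \<le> real d powr \<alpha> / \<alpha>"
proof (induction d)
  case (Suc d)
  have "\<alpha> * real (Suc d) powr (\<alpha> - 1) \<le> real (Suc d) powr \<alpha> - real d powr \<alpha>"
  proof (cases "d = 0")
    case True
    then show ?thesis using assms by simp
  next
    case False
    have "\<exists>z. real d < z \<and> z < real (Suc d) \<and>
        real (Suc d) powr \<alpha> - real d powr \<alpha> = (real (Suc d) - real d) * (\<alpha> * z powr (\<alpha> - 1))"
      using False by (intro MVT2) (auto intro!: has_real_derivative_powr)
    then obtain z where z: "real d < z" "z < real (Suc d)"
      "real (Suc d) powr \<alpha> - real d powr \<alpha> = \<alpha> * z powr (\<alpha> - 1)"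
      by auto
    have "real (Suc d) powr (\<alpha> - 1) \<le> z powr (\<alpha> - 1)"
      using z assms by (intro powr_mono2') auto
    then show ?thesis using z(3) assms by simp
  qed
  then have "real (Suc d) powr (\<alpha> - 1) \<le> real (Suc d) powr \<alpha> / \<alpha> - real d powr \<alpha> / \<alpha>"
    using assms by (simp add: field_simps)
  then show ?case using Suc by simp
qed simp

lemma sum_shift_telescope:
  fixes a :: "nat \<Rightarrow> real"
  shows "(\<Sum>r<n. a (r + 1) - a (r + 1 + d)) = (\<Sum>i = 1..d. a i) - (\<Sum>i = 1..d. a (n + i))"
proof (induction n)
  case (Suc n)
  have "(\<Sum>i = 1..d. a (n + i) - a (Suc n + i)) = a (n + 1) - a (n + 1 + d)"
    by (induction d) auto
  then show ?case using Suc by (simp add: sum_subtractf algebra_simps)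
qed simp

text \<open>
  By the inversion formula a shift difference of \<open>v\<close> is a convolution of the discrete derivative
  with a kernel made of two parts: the differences \<open>a (r + 1) - a (r + 1 + d)\<close> of the decreasing sequence \<open>a r = r\<^sup>\<alpha>\<^sup>-\<^sup>1\<close>, acting on
  the cells up to \<open>k\<close>, and the values \<open>a 1, \<dots>, a d\<close>, acting on the \<open>d\<close> cells after \<open>k\<close>. Each part has
  total mass at most \<open>a 1 + \<dots> + a d \<le> d\<^sup>\<alpha> / \<alpha>\<close>, and the initial value \<open>v 0\<close> cancels.
\<close>

lemma discrete_caputo_shift_estimate:
  fixes v :: "nat \<Rightarrow> 'a::real_normed_vector"
  assumes T: "0 < T" "1 \<le> N" "1 \<le> p" and \<alpha>: "0 < \<alpha>" "\<alpha> < 1" and B: "0 \<le> B"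
    and D: "grid_norm p T N (discrete_caputo \<alpha> (T / real N) v) \<le> ennreal B"
  shows "grid_norm p T N (\<lambda>k. if k + d \<le> N then v (k + d) - v k else 0)
       \<le> ennreal (2 * B / (\<alpha> * Gamma \<alpha>) * (real d * (T / real N)) powr \<alpha>)"
proof -
  define \<tau> where "\<tau> = T / real N"
  define g where "g = discrete_caputo \<alpha> \<tau> v"
  define c where "c = Gamma \<alpha> * \<tau> powr (- \<alpha>)"
  define a where "a r = real r powr (\<alpha> - 1)" for r :: nat
  \<comment> \<open>the left summand runs over distances \<open>r = k - l\<close> to earlier cells, the right one over \<open>i = l - k\<close> to later cells\<close>
  define I where "I = {..<N} <+> {1..d}"
  define coef where "coef = case_sum (\<lambda>r. (a (r + 1) - a (r + 1 + d)) / c) (\<lambda>i. a (d - i + 1) / c)"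
  define u where "u = case_sum (\<lambda>r k. if r < k then g (k - r) else 0) (\<lambda>i k. if k + i \<le> N then g (k + i) else 0)"
  have \<tau>: "0 < \<tau>" using T by (simp add: \<tau>_def)
  have c: "0 < c" using \<tau> \<alpha> by (simp add: c_def Gamma_real_pos)
  have anti: "a (r + 1 + e) \<le> a (r + 1)" for r e
    using \<alpha> unfolding a_def by (intro powr_mono2') auto
  have a0: "0 \<le> a r" for r by (simp add: a_def)
  have "grid_norm p T N (\<lambda>k. if k + d \<le> N then v (k + d) - v k else 0)
      \<le> ennreal (\<Sum>i\<in>I. coef i * B)"
  proof (rule grid_norm_sum_le[OF T, where u = u])
    show "finite I" by (simp add: I_def)
    show "0 \<le> coef i" if "i \<in> I" for i
      using c anti a0 by (cases i) (auto simp: coef_def intro!: divide_nonneg_pos)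
    show "0 \<le> B" by fact
    show "grid_norm p T N (u i) \<le> ennreal B" if "i \<in> I" for i
    proof (cases i)
      case (Inl r)
      show ?thesis
        by (rule grid_norm_reindex_le[OF T B, where K = "{k\<in>{1..N}. r < k}" and \<sigma> = "\<lambda>k. k - r", OF _ _ _ _ _ D])
           (auto simp: Inl u_def g_def \<tau>_def inj_on_def)
    next
      case (Inr r)
      show ?thesis
        by (rule grid_norm_reindex_le[OF T B, where K = "{k\<in>{1..N}. k + r \<le> N}" and \<sigma> = "\<lambda>k. k + r", OF _ _ _ _ _ D])
           (auto simp: Inr u_def g_def \<tau>_def inj_on_def)
    qed
    show "norm (if k + d \<le> N then v (k + d) - v k else 0) \<le> (\<Sum>i\<in>I. coef i * norm (u i k))"
      if k: "k \<in> {1..N}" for k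
    proof (cases "k + d \<le> N")
      case False
      then show ?thesis
        using c anti a0 by (auto simp: coef_def I_def intro!: sum_nonneg mult_nonneg_nonneg divide_nonneg_pos)
    next
      case True
      have split: "(\<Sum>l = 1..k + d. h l) = (\<Sum>l = 1..k. h l) + (\<Sum>l = k + 1..k + d. h l)" for h :: "nat \<Rightarrow> 'a"
        by (rule sum.ub_add_nat) auto
      have "c *\<^sub>R (v (k + d) - v k) = c *\<^sub>R (v (k + d) - v 0) - c *\<^sub>R (v k - v 0)"
        by (simp add: algebra_simps)
      also have "\<dots> = (\<Sum>l = 1..k + d. a (k + d - l + 1) *\<^sub>R g l) - (\<Sum>l = 1..k. a (k - l + 1) *\<^sub>R g l)"
        unfolding c_def a_def g_def discrete_caputo_inversion ..
      also have "\<dots> = (\<Sum>l = 1..k. (a (k + d - l + 1) - a (k - l + 1)) *\<^sub>R g l)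
          + (\<Sum>l = k + 1..k + d. a (k + d - l + 1) *\<^sub>R g l)"
        unfolding split by (simp add: scaleR_left_diff_distrib sum_subtractf)
      also have "(\<Sum>l = 1..k. (a (k + d - l + 1) - a (k - l + 1)) *\<^sub>R g l)
          = (\<Sum>r<k. (a (r + 1 + d) - a (r + 1)) *\<^sub>R g (k - r))"
        by (rule sum.reindex_bij_witness[of _ "\<lambda>r. k - r" "\<lambda>l. k - l"])
           (auto simp: Suc_diff_le algebra_simps)
      also have "(\<Sum>l = k + 1..k + d. a (k + d - l + 1) *\<^sub>R g l) = (\<Sum>i = 1..d. a (d - i + 1) *\<^sub>R g (k + i))"
        by (rule sum.reindex_bij_witness[of _ "\<lambda>i. k + i" "\<lambda>l. l - k"])
           (auto simp: add.commute)
      finally have "c * norm (v (k + d) - v k)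
          = norm ((\<Sum>r<k. (a (r + 1 + d) - a (r + 1)) *\<^sub>R g (k - r)) + (\<Sum>i = 1..d. a (d - i + 1) *\<^sub>R g (k + i)))"
        using c by (metis abs_of_pos norm_scaleR)
      also have "\<dots> \<le> (\<Sum>r<k. norm ((a (r + 1 + d) - a (r + 1)) *\<^sub>R g (k - r)))
          + (\<Sum>i = 1..d. norm (a (d - i + 1) *\<^sub>R g (k + i)))"
        by (rule order_trans[OF norm_triangle_ineq]) (intro add_mono norm_sum)
      also have "\<dots> = (\<Sum>r<k. (a (r + 1) - a (r + 1 + d)) * norm (g (k - r)))
          + (\<Sum>i = 1..d. a (d - i + 1) * norm (g (k + i)))"
        using anti a0 by (simp add: abs_minus_commute)
      also have "(\<Sum>r<k. (a (r + 1) - a (r + 1 + d)) * norm (g (k - r)))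
          = (\<Sum>r<N. (a (r + 1) - a (r + 1 + d)) * norm (u (Inl r) k))"
        using k by (intro sum.mono_neutral_cong_left) (auto simp: u_def)
      also have "(\<Sum>i = 1..d. a (d - i + 1) * norm (g (k + i)))
          = (\<Sum>i = 1..d. a (d - i + 1) * norm (u (Inr i) k))"
        using True by (intro sum.cong) (auto simp: u_def)
      finally have "norm (v (k + d) - v k)
          \<le> ((\<Sum>r<N. (a (r + 1) - a (r + 1 + d)) * norm (u (Inl r) k))
          + (\<Sum>i = 1..d. a (d - i + 1) * norm (u (Inr i) k))) / c"
        using c by (simp add: pos_le_divide_eq mult.commute)
      also have "\<dots> = (\<Sum>i\<in>I. coef i * norm (u i k))"
        unfolding I_def by (subst sum.Plus) (auto simp: coef_def add_divide_distrib sum_divide_distrib)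
      finally show ?thesis using True by simp
    qed
  qed
  also have "(\<Sum>i\<in>I. coef i * B) \<le> 2 * B / (\<alpha> * Gamma \<alpha>) * (real d * \<tau>) powr \<alpha>"
  proof -
    have rev: "(\<Sum>i = 1..d. a (d - i + 1)) = (\<Sum>i = 1..d. a i)"
      by (rule sum.reindex_bij_witness[of _ "\<lambda>i. d - i + 1" "\<lambda>i. d - i + 1"]) auto
    have "(\<Sum>i\<in>I. coef i * B) = ((\<Sum>r<N. a (r + 1) - a (r + 1 + d)) + (\<Sum>i = 1..d. a (d - i + 1))) / c * B"
      unfolding I_def by (subst sum.Plus)
        (auto simp: coef_def add_divide_distrib sum_divide_distrib distrib_right sum_distrib_right)
    also have "\<dots> \<le> (2 * (real d powr \<alpha> / \<alpha>)) / c * B"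
    proof (intro mult_right_mono divide_right_mono)
      have "(\<Sum>r<N. a (r + 1) - a (r + 1 + d)) \<le> (\<Sum>i = 1..d. a i)"
        unfolding sum_shift_telescope using a0 by (simp add: sum_nonneg)
      then show "(\<Sum>r<N. a (r + 1) - a (r + 1 + d)) + (\<Sum>i = 1..d. a (d - i + 1)) \<le> 2 * (real d powr \<alpha> / \<alpha>)"
        using sum_powr_le[of \<alpha> d] \<alpha> unfolding rev by (simp add: a_def)
    qed (use c B in auto)
    also have "\<dots> = 2 * B / (\<alpha> * Gamma \<alpha>) * (real d * \<tau>) powr \<alpha>"
      using \<tau> by (simp add: c_def powr_minus powr_mult field_simps)
    finally show ?thesis .
  qed
  finally show ?thesis by (simp add: \<tau>_def ennreal_leI)
qed


section \<open>Ehrling's inequality\<close>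

text \<open>
  If the inequality fails for every constant \<open>n\<close>, there are unit vectors \<open>y n\<close> with \<open>|i (y n)| \<ge> \<epsilon>\<close> and
  \<open>|j (i (y n))| \<le> K / n\<close>. By compactness their images accumulate at some \<open>b\<close> with \<open>|b| \<ge> \<epsilon>\<close> and
  \<open>j b = 0\<close>, against injectivity of \<open>j\<close>.
\<close>

lemma ehrling_inequality:
  fixes i :: "'x::real_normed_vector \<Rightarrow> 'b::real_normed_vector" and j :: "'b \<Rightarrow> 'y::real_normed_vector"
  assumes i: "compact_embedding i" and j: "continuous_embedding j" and \<epsilon>: "0 < \<epsilon>"
  obtains C where "0 \<le> C" "\<And>x. norm (i x) \<le> \<epsilon> * norm x + C * norm (j (i x))"
proof -
  have bi: "bounded_linear i" and bj: "bounded_linear j" and injj: "inj j"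
    using i j by (auto simp: compact_embedding_def continuous_embedding_def)
  interpret i: bounded_linear i by fact
  interpret j: bounded_linear j by fact
  have "\<exists>n::nat. \<forall>x. norm (i x) \<le> \<epsilon> * norm x + real n * norm (j (i x))"
  proof (rule ccontr)
    assume "\<not> ?thesis"
    then have "\<forall>n::nat. \<exists>x. norm (i x) > \<epsilon> * norm x + real n * norm (j (i x))"
      by (simp add: not_le)
    then obtain x where x: "\<And>n::nat. norm (i (x n)) > \<epsilon> * norm (x n) + real n * norm (j (i (x n)))"
      by metis
    define y where "y n = (1 / norm (x n)) *\<^sub>R x n" for n
    have x0: "x n \<noteq> 0" for n
      using x[of n] by (auto simp: i.zero)
    have y1: "norm (y n) = 1" for n
      using x0[of n] by (simp add: y_def)
    have y: "\<epsilon> + real n * norm (j (i (y n))) < norm (i (y n))" for n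
    proof -
      have "(\<epsilon> * norm (x n) + real n * norm (j (i (x n)))) / norm (x n) < norm (i (x n)) / norm (x n)"
        using x[of n] x0[of n] by (intro divide_strict_right_mono) auto
      then show ?thesis using x0[of n] by (simp add: y_def i.scaleR j.scaleR add_divide_distrib)
    qed
    have "bounded (range y)"
      using y1 by (auto simp: bounded_iff)
    then have "compact (closure (i ` range y))"
      using i by (simp add: compact_embedding_def)
    then have "seq_compact (closure (i ` range y))"
      by (rule compact_imp_seq_compact)
    moreover have "\<forall>n. i (y n) \<in> closure (i ` range y)"
      by (intro allI closure_subset[THEN subsetD]) simp
    ultimately obtain b r where r: "strict_mono (r :: nat \<Rightarrow> nat)"
      and lim: "((\<lambda>n. i (y n)) \<circ> r) \<longlonglongrightarrow> b"
      by (rule seq_compactE)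
    have lim: "(\<lambda>n. i (y (r n))) \<longlonglongrightarrow> b" using lim by (simp add: o_def)
    have "norm b \<ge> \<epsilon>"
    proof (rule LIMSEQ_le_const[OF tendsto_norm[OF lim]])
      have "\<epsilon> \<le> norm (i (y n))" for n
      proof -
        have "0 \<le> real n * norm (j (i (y n)))" by simp
        then show ?thesis using y[of n] by linarith
      qed
      then show "\<exists>N. \<forall>n\<ge>N. \<epsilon> \<le> norm (i (y (r n)))" by blast
    qed
    obtain K where K: "\<And>z. norm (i z) \<le> norm z * K"
      using bounded_linear.bounded[OF bi] by metis
    have small: "norm (j (i (y (r n)))) \<le> K * inverse (real n)" if "0 < n" for n
    proof -
      have "real n * norm (j (i (y (r n)))) \<le> real (r n) * norm (j (i (y (r n))))"
        using strict_mono_imp_increasing[OF r, of n] by (intro mult_right_mono) auto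
      also have "\<dots> \<le> K" using y[of "r n"] K[of "y (r n)"] y1[of "r n"] \<epsilon> by simp
      finally show ?thesis using that by (simp add: field_simps)
    qed
    have "(\<lambda>n. K * inverse (real n)) \<longlonglongrightarrow> 0"
      by (intro tendsto_mult_right_zero lim_inverse_n)
    then have "(\<lambda>n. j (i (y (r n)))) \<longlonglongrightarrow> 0"
      by (rule Lim_null_comparison[rotated], intro eventually_sequentiallyI[of 1] small) simp
    moreover have "(\<lambda>n. j (i (y (r n)))) \<longlonglongrightarrow> j b"
      by (rule j.tendsto[OF lim])
    ultimately have "j b = j 0"
      using LIMSEQ_unique j.zero by metis
    then have "b = 0" by (rule injD[OF injj])
    then show False using \<open>norm b \<ge> \<epsilon>\<close> \<epsilon> by simp
  qed
  then show thesis using that by (metis of_nat_0_le_iff)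
qed


section \<open>Approximation by block averages\<close>

text \<open>
  The blocks consist of \<open>s\<close> consecutive indices and are numbered from \<open>1\<close>, like the cells of a grid.
\<close>

definition block_average :: "nat \<Rightarrow> (nat \<Rightarrow> 'a::real_normed_vector) \<Rightarrow> nat \<Rightarrow> 'a" where
  "block_average s v m = (1 / real s) *\<^sub>R (\<Sum>k\<in>{(m - 1) * s<..m * s}. v k)"

lemma card_block:
  assumes "1 \<le> m" shows "card {(m - 1) * s<..m * s} = s"
  using assms by (cases m) auto

lemma block_average_linear:
  assumes "linear h"
  shows "h (block_average s v m) = block_average s (\<lambda>k. h (v k)) m"
  using assms by (simp add: block_average_def linear_cmul linear_sum o_def)

text \<open>
  With \<open>s = N div M\<close>, the \<open>m\<close>-th block of fine cells need not fill the \<open>m\<close>-th coarse cell, because \<open>M\<close> need not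
  divide \<open>N\<close>. The misfit is at most \<open>M + 1\<close> fine cells, which is absorbed by one more block length as soon as
  \<open>M + 1 \<le> s\<close>.
\<close>

lemma block_near_grid_index:
  assumes T: "0 < T" and M: "1 \<le> M" "M + 1 \<le> N div M" and t: "0 < t" "t < T"
    and k: "k \<in> {(grid_index T M t - 1) * (N div M)<..grid_index T M t * (N div M)}"
  shows "k \<in> {1..N}" "\<bar>int k - int (grid_index T N t)\<bar> \<le> int (2 * (N div M))"
proof -
  define s where "s = N div M"
  define m where "m = grid_index T M t"
  define n where "n = grid_index T N t"
  define x where "x = t / T"
  have sN: "s * M \<le> N" "N < s * M + M"
    using M div_mult_mod_eq[of N M] mod_less_divisor[of M N] unfolding s_def
    by (linarith, linarith)
  have N: "1 \<le> N" using M by (cases "N = 0") auto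
  have x: "0 < x" "x < 1" using T t by (auto simp: x_def)
  have m: "m \<in> {1..M}" "real m - 1 < x * real M" "x * real M \<le> real m"
    using grid_index_bounds[OF T M(1) t] by (auto simp: m_def x_def)
  have n: "n \<in> {1..N}" "real n - 1 < x * real N" "x * real N \<le> real n"
    using grid_index_bounds[OF T N t] by (auto simp: n_def x_def)
  have k': "(m - 1) * s < k" "k \<le> m * s" using k by (auto simp: s_def m_def)
  have "m * s \<le> M * s" using m by simp
  moreover have "M * s \<le> N" using sN(1) by (simp add: mult.commute)
  ultimately have "k \<le> N" using k'(2) by linarith
  then show "k \<in> {1..N}" using k'(1) by simp
  have "real N \<le> real s * real M + real M" using sN(2) by (simp flip: of_nat_mult of_nat_add)
  then have "x * real N \<le> x * (real s * real M + real M)" using x by (intro mult_left_mono) auto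
  also have "\<dots> = real s * (x * real M) + x * real M" by (simp add: algebra_simps)
  also have "\<dots> \<le> real s * real m + real M"
    using m x by (intro add_mono mult_left_mono) (auto intro: mult_left_le_one_le)
  finally have "real n < real s * real m + real M + 1" using n by linarith
  then have "n < s * m + M + 1" by (simp flip: of_nat_mult of_nat_add of_nat_Suc add: of_nat_less_iff)
  moreover have "s * m \<le> k + s"
    using k'(1) m(1) by (cases m) (auto simp: mult.commute)
  ultimately have 1: "n \<le> k + 2 * s" using M(2) by (simp add: s_def)
  have "real s * (real m - 1) \<le> real s * (x * real M)" using m by (intro mult_left_mono) auto
  also have "\<dots> = x * real (s * M)" by simp
  also have "\<dots> \<le> x * real N" using sN(1) x by (intro mult_left_mono) (auto simp del: of_nat_mult)
  also have "\<dots> \<le> real n" by (rule n(3))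
  finally have "real (s * m) \<le> real (n + s)" by (simp add: algebra_simps)
  then have "s * m \<le> n + s" by (simp only: of_nat_le_iff)
  then have 2: "k \<le> n + 2 * s" using k'(2) by (simp add: mult.commute)
  show "\<bar>int k - int (grid_index T N t)\<bar> \<le> int (2 * (N div M))"
    using 1 2 unfolding n_def[symmetric] s_def[symmetric] by linarith
qed

text \<open>
  At time \<open>t\<close> in the fine cell \<open>n\<close> and the coarse cell \<open>m\<close>, the error is the mean of \<open>v n - v k\<close> over the block
  \<open>m\<close>. Since \<open>|k - n| \<le> 2 s\<close>, its norm is at most \<open>1 / s\<close> times the sum of all shift differences at \<open>n\<close> with
  shifts from \<open>-2 s\<close> to \<open>2 s\<close>. These are \<open>4 s + 1 \<le> 5 s\<close> functions on the fine grid, and by Minkowski's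
  inequality their mean with weights \<open>1 / s\<close> has norm at most \<open>5 b\<close>.
\<close>

lemma block_average_error:
  fixes v :: "nat \<Rightarrow> 'a::real_normed_vector"
  assumes T: "0 < T" and p: "1 \<le> p" and M: "1 \<le> M" "M + 1 \<le> N div M" and b: "0 \<le> b"
    and shift: "\<And>d. d \<le> 2 * (N div M) \<Longrightarrow>
      grid_norm p T N (\<lambda>k. if k + d \<le> N then v (k + d) - v k else 0) \<le> ennreal b"
  shows "Lp_norm p (lebesgue_on {0<..<T})
      (\<lambda>t. piecewise_const (T / real N) v t - piecewise_const (T / real M) (block_average (N div M) v) t)
    \<le> ennreal (5 * b)"
proof -
  define s where "s = N div M"
  define L where "L = lebesgue_on {0<..<T}"
  \<comment> \<open>shift differences in both directions, zero where the shift leaves the grid\<close>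
  define u where "u d k = (if 1 \<le> int k + d \<and> int k + d \<le> int N then v (nat (int k + d)) - v k else 0)" for d k
  define D where "D = {- int (2 * s)..int (2 * s)}"
  have s: "1 \<le> s" using M by (simp add: s_def)
  have N: "1 \<le> N" using M by (cases "N = 0") auto
  have ub: "grid_norm p T N (u d) \<le> ennreal b" if d: "d \<in> D" for d
  proof -
    define e where "e = nat \<bar>d\<bar>"
    have e: "e \<le> 2 * (N div M)" using d by (auto simp: D_def s_def e_def)
    \<comment> \<open>a backward shift difference at \<open>k\<close> is, up to sign, the forward one at \<open>k + d\<close>\<close>
    show ?thesis
    proof (rule grid_norm_reindex_le[OF T N p b, where K = "{k\<in>{1..N}. 1 \<le> int k + d \<and> int k + d \<le> int N}"
          and \<sigma> = "\<lambda>k. if 0 \<le> d then k else nat (int k + d)", OF _ _ _ _ _ shift[OF e]])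
      fix k assume k: "k \<in> {k\<in>{1..N}. 1 \<le> int k + d \<and> int k + d \<le> int N}"
      show "norm (u d k) \<le> norm (if (if 0 \<le> d then k else nat (int k + d)) + e \<le> N
          then v ((if 0 \<le> d then k else nat (int k + d)) + e) - v (if 0 \<le> d then k else nat (int k + d)) else 0)"
      proof (cases "0 \<le> d")
        case True
        then have "nat (int k + d) = k + e" "k + e \<le> N" using k by (auto simp: e_def)
        then show ?thesis using True k by (simp add: u_def)
      next
        case False
        then have "nat (int k + d) + e = k" using k by (auto simp: e_def)
        then show ?thesis using False k by (auto simp: u_def norm_minus_commute)
      qed
    qed (auto simp: u_def inj_on_def)
  qed
  have "Lp_norm p L
      (\<lambda>t. piecewise_const (T / real N) v t - piecewise_const (T / real M) (block_average s v) t)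
    \<le> ennreal (\<Sum>d\<in>D. 1 / real s * b)"
  proof (rule Lp_norm_sum_le[OF p, where u = "\<lambda>d. piecewise_const (T / real N) (u d)"])
    show "(\<lambda>t. norm (piecewise_const (T / real N) (u d) t)) \<in> borel_measurable L" for d
      unfolding L_def by (rule measurable_piecewise_const)
    show "(\<lambda>t. norm (piecewise_const (T / real N) v t - piecewise_const (T / real M) (block_average s v) t))
        \<in> borel_measurable L"
      unfolding L_def by (rule measurable_two_grids)
    show "Lp_norm p L (piecewise_const (T / real N) (u d)) \<le> ennreal b" if "d \<in> D" for d
      using ub[OF that] by (simp add: grid_norm_def L_def)
    show "AE t in L. norm (piecewise_const (T / real N) v t - piecewise_const (T / real M) (block_average s v) t)
        \<le> (\<Sum>d\<in>D. 1 / real s * norm (piecewise_const (T / real N) (u d) t))"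
    proof (rule AE_I2)
      fix t assume "t \<in> space L"
      then have t: "0 < t" "t < T" by (auto simp: L_def)
      define n where "n = grid_index T N t"
      define m where "m = grid_index T M t"
      define K where "K = {(m - 1) * s<..m * s}"
      have n: "n \<in> {1..N}" using grid_index_bounds(1)[OF T N t] by (simp add: n_def)
      have m: "1 \<le> m" using grid_index_bounds(1)[OF T M(1) t] by (simp add: m_def)
      have near: "k \<in> {1..N}" "int k - int n \<in> D" if "k \<in> K" for k
        using block_near_grid_index[OF T M t, of k] that by (auto simp: K_def m_def n_def s_def D_def)
      have "v n = (1 / real s) *\<^sub>R (\<Sum>k\<in>K. v n)"
        using card_block[OF m, of s] s by (simp add: K_def scaleR_sum_left[symmetric] sum_constant_scaleR)
      then have "v n - block_average s v m = (1 / real s) *\<^sub>R (\<Sum>k\<in>K. v n - v k)"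
        unfolding block_average_def K_def[symmetric] by (simp add: sum_subtractf scaleR_right_diff_distrib)
      then have "norm (v n - block_average s v m) \<le> 1 / real s * (\<Sum>k\<in>K. norm (v n - v k))"
        using s by (simp add: divide_right_mono norm_sum)
      also have "(\<Sum>k\<in>K. norm (v n - v k)) = (\<Sum>k\<in>K. norm (u (int k - int n) n))"
        using near by (intro sum.cong) (auto simp: u_def norm_minus_commute)
      also have "\<dots> = (\<Sum>d\<in>(\<lambda>k. int k - int n) ` K. norm (u d n))"
        by (subst sum.reindex) (auto simp: inj_on_def)
      also have "\<dots> \<le> (\<Sum>d\<in>D. norm (u d n))"
        using near by (intro sum_mono2) (auto simp: D_def)
      finally have "norm (v n - block_average s v m) \<le> 1 / real s * (\<Sum>d\<in>D. norm (u d n))"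
        using s by (simp add: divide_right_mono)
      then show "norm (piecewise_const (T / real N) v t - piecewise_const (T / real M) (block_average s v) t)
        \<le> (\<Sum>d\<in>D. 1 / real s * norm (piecewise_const (T / real N) (u d) t))"
        by (simp add: piecewise_const_grid_index n_def m_def sum_distrib_left sum_divide_distrib)
    qed
  qed (use b in \<open>auto simp: D_def\<close>)
  also have "(\<Sum>d\<in>D. 1 / real s * b) = (4 * real s + 1) / real s * b"
    by (simp add: D_def)
  also have "\<dots> \<le> 5 * b"
    using s b by (intro mult_right_mono) (auto simp: field_simps)
  finally show ?thesis by (simp add: L_def s_def ennreal_leI)
qed


section \<open>Relative compactness\<close>

text \<open>
  Uniformly over all admissible grid functions there are a bound \<open>M0\<close> for the number of cells and a bound \<open>R\<close>
  for the values in the smallest space, so that the approximants form a finite union of families with finitely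
  many parameters.
\<close>

lemma coarse_approximation:
  fixes i :: "'x::real_normed_vector \<Rightarrow> 'b::real_normed_vector" and j :: "'b \<Rightarrow> 'y::real_normed_vector"
  assumes i: "compact_embedding i" and j: "continuous_embedding j"
    and T: "0 < T" and p: "1 \<le> p" and \<alpha>: "0 < \<alpha>" "\<alpha> < 1" and B: "0 \<le> B" and \<epsilon>: "0 < \<epsilon>"
  obtains M0 R where "\<And>N f f0. \<lbrakk>1 \<le> N; grid_norm p T N f \<le> ennreal B;
      grid_norm p T N (discrete_caputo \<alpha> (T / real N) ((\<lambda>k. j (i (f k)))(0 := f0))) \<le> ennreal B\<rbrakk>
    \<Longrightarrow> \<exists>M\<in>{1..M0}. \<exists>v. (\<forall>k\<in>{1..M}. norm (v k) \<le> R) \<and>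
        Lp_norm p (lebesgue_on {0<..<T})
          (\<lambda>t. i (piecewise_const (T / real N) f t) - i (piecewise_const (T / real M) v t)) \<le> ennreal \<epsilon>"
proof -
  have li: "linear i" and lj: "linear j"
    using i j by (auto simp: compact_embedding_def continuous_embedding_def bounded_linear.linear)
  have lji: "linear (\<lambda>x. j (i x))"
    using linear_compose[OF li lj] by (simp add: o_def)
  define L where "L = lebesgue_on {0<..<T}"
  \<comment> \<open>the error of the averages in the smallest space will be at most \<open>10 B\<close>, so this \<open>\<delta>\<close> spends half of \<open>\<epsilon>\<close>\<close>
  define \<delta> where "\<delta> = \<epsilon> / (20 * (B + 1))"
  have \<delta>: "0 < \<delta>" "\<delta> * (10 * B) \<le> \<epsilon> / 2"
    using B \<epsilon> by (auto simp: \<delta>_def field_simps)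
  obtain C where C: "0 \<le> C" "\<And>x. norm (i x) \<le> \<delta> * norm x + C * norm (j (i x))"
    by (rule ehrling_inequality[OF i j \<delta>(1)]) (rule that)
  define K where "K = 2 * B / (\<alpha> * Gamma \<alpha>)"
  have K: "0 \<le> K" using B \<alpha> Gamma_real_pos[of \<alpha>] by (simp add: K_def)
  have "(\<lambda>M. C * (5 * (K * (2 * T / real M) powr \<alpha>))) \<longlonglongrightarrow> 0"
    using T \<alpha> by (intro tendsto_mult_right_zero tendsto_zero_powrI[OF _ tendsto_const] lim_const_over_n) auto
  then have "\<forall>\<^sub>F M in sequentially. C * (5 * (K * (2 * T / real M) powr \<alpha>)) < \<epsilon> / 2"
    by (rule order_tendstoD) (use \<epsilon> in simp)
  then have "\<forall>\<^sub>F M in sequentially. 1 \<le> M \<and> C * (5 * (K * (2 * T / real M) powr \<alpha>)) < \<epsilon> / 2"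
    using eventually_ge_at_top[of 1] by eventually_elim simp
  then have "\<exists>M. 1 \<le> M \<and> C * (5 * (K * (2 * T / real M) powr \<alpha>)) < \<epsilon> / 2"
    by (rule eventually_happens'[OF sequentially_bot])
  then obtain M where M: "1 \<le> M" and small: "C * (5 * (K * (2 * T / real M) powr \<alpha>)) < \<epsilon> / 2"
    by (elim exE conjE) (rule that)
  define C1 where "C1 = 1 + B + B powr enn2real p"
  have C1: "0 \<le> C1" using B by (simp add: C1_def)
  \<comment> \<open>from \<open>M0\<close> fine cells on, a block has at least \<open>M + 1\<close> indices, as \<open>block_average_error\<close> requires\<close>
  define M0 where "M0 = M * (M + 1)"
  define R where "R = C1 * (1 + 2 * real M0 / T)"
  have MM0: "M \<le> M0" by (simp add: M0_def)
  show thesis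
  proof (rule that[of M0 R])
    fix N :: nat and f f0
    assume N: "1 \<le> N" and fX: "grid_norm p T N f \<le> ennreal B"
      and fY: "grid_norm p T N (discrete_caputo \<alpha> (T / real N) ((\<lambda>k. j (i (f k)))(0 := f0))) \<le> ennreal B"
    show "\<exists>M\<in>{1..M0}. \<exists>v. (\<forall>k\<in>{1..M}. norm (v k) \<le> R) \<and>
        Lp_norm p (lebesgue_on {0<..<T})
          (\<lambda>t. i (piecewise_const (T / real N) f t) - i (piecewise_const (T / real M) v t)) \<le> ennreal \<epsilon>"
    proof (cases "N < M0")
      case True
      \<comment> \<open>a grid with fewer than \<open>M0\<close> cells serves as its own approximating grid\<close>
      have "norm (f k) \<le> R" if k: "k \<in> {1..N}" for k
      proof -
        have "norm (f k) \<le> C1 * (1 + real N / T)"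
          using grid_norm_partial_sum_le[OF T N p B fX, of "{k}"] k by (simp add: C1_def)
        also have "\<dots> \<le> R"
          unfolding R_def using True C1 T by (intro mult_left_mono add_mono divide_right_mono) auto
        finally show ?thesis .
      qed
      moreover have "Lp_norm p (lebesgue_on {0<..<T})
          (\<lambda>t. i (piecewise_const (T / real N) f t) - i (piecewise_const (T / real N) f t)) = 0"
        by (subst Lp_norm_eq_0[OF p]) auto
      ultimately show ?thesis using True N
        by (intro bexI[of _ N] exI[of _ f]) auto
    next
      case False
      define s where "s = N div M"
      have sM: "M + 1 \<le> s"
        using False M unfolding s_def M0_def by (simp add: less_eq_div_iff_mult_less_eq mult.commute)
      have s: "0 < s" using sM by simp
      have sMN: "s * M \<le> N" by (simp add: s_def)
      have NsM: "N \<le> 2 * (s * M)"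
      proof -
        have "N < s * M + M"
          using div_mult_mod_eq[of N M] mod_less_divisor[of M N] M unfolding s_def by linarith
        moreover have "M \<le> s * M" using s by simp
        ultimately show ?thesis by linarith
      qed
      define A where "A = block_average s f"
      define g where "g k = j (i (f k))" for k
      have Abound: "norm (A m) \<le> R" if m: "m \<in> {1..M}" for m
      proof -
        let ?K = "{(m - 1) * s<..m * s}"
        have "m * s \<le> M * s" using m by simp
        moreover have "M * s \<le> N" using sMN by (simp add: mult.commute)
        ultimately have "m * s \<le> N" by linarith
        then have sub: "?K \<subseteq> {1..N}" by auto
        have "norm (A m) \<le> (1 / real s) * (\<Sum>k\<in>?K. norm (f k))"
          unfolding A_def block_average_def using s by (simp add: divide_right_mono norm_sum)
        also have "\<dots> \<le> (1 / real s) * (C1 * (real s + real N / T))"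
        proof (rule mult_left_mono)
          have "1 \<le> m" using m by simp
          then show "(\<Sum>k\<in>?K. norm (f k)) \<le> C1 * (real s + real N / T)"
            using grid_norm_partial_sum_le[OF T N p B fX sub] by (simp only: C1_def card_block)
        qed simp
        also have "\<dots> = C1 * (1 + real N / real s / T)"
          using s T by (simp add: field_simps)
        also have "\<dots> \<le> C1 * (1 + 2 * real M0 / T)"
        proof (intro mult_left_mono add_left_mono divide_right_mono)
          have "real N \<le> real (2 * (s * M))" using NsM by (simp only: of_nat_le_iff)
          then have "real N / real s \<le> 2 * real M" using s by (simp add: field_simps)
          also have "\<dots> \<le> 2 * real M0" using MM0 by simp
          finally show "real N / real s \<le> 2 * real M0" .
        qed (use T C1 in auto)
        finally show ?thesis by (simp add: R_def)
      qed
      have X: "Lp_norm p L (\<lambda>t. piecewise_const (T / real N) f t - piecewise_const (T / real M) A t)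
          \<le> ennreal (5 * (2 * B))"
        unfolding L_def A_def s_def
      proof (rule block_average_error[OF T p M sM[unfolded s_def]])
        fix d
        \<comment> \<open>only boundedness is claimed here: both terms of the difference have norm at most \<open>B\<close>\<close>
        define u where "u b k = (if b then f k else if k + d \<le> N then f (k + d) else 0)" for b k
        have "grid_norm p T N (\<lambda>k. if k + d \<le> N then f (k + d) - f k else 0)
            \<le> ennreal (\<Sum>b\<in>(UNIV::bool set). 1 * B)"
        proof (rule grid_norm_sum_le[OF T N p, where u = u])
          show "grid_norm p T N (u b) \<le> ennreal B" for b
            by (cases b; rule grid_norm_reindex_le[OF T N p B,
                where K = "{k\<in>{1..N}. b \<or> k + d \<le> N}" and \<sigma> = "\<lambda>k. if b then k else k + d", OF _ _ _ _ _ fX])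
              (auto simp: u_def inj_on_def)
          show "norm (if k + d \<le> N then f (k + d) - f k else 0) \<le> (\<Sum>b\<in>UNIV. 1 * norm (u b k))" for k
            using norm_triangle_ineq4[of "f (k + d)" "f k"] by (simp add: u_def UNIV_bool)
        qed (use B in auto)
        then show "grid_norm p T N (\<lambda>k. if k + d \<le> N then f (k + d) - f k else 0) \<le> ennreal (2 * B)"
          by (simp add: UNIV_bool)
      qed (use B in simp)
      have Y: "Lp_norm p L (\<lambda>t. piecewise_const (T / real N) g t - piecewise_const (T / real M) (block_average s g) t)
          \<le> ennreal (5 * (K * (2 * T / real M) powr \<alpha>))"
        unfolding L_def s_def
      proof (rule block_average_error[OF T p M sM[unfolded s_def]])
        fix d assume d: "d \<le> 2 * (N div M)"
        \<comment> \<open>the derivative involves the given initial value, but the shift differences only involve indices from \<open>1\<close> on\<close>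
        define g' where "g' = g(0 := f0)"
        have g': "(\<lambda>k. j (i (f k)))(0 := f0) = g'" by (auto simp: g'_def g_def)
        have "real d * (T / real N) \<le> 2 * T / real M"
        proof -
          have "d * M \<le> 2 * s * M" using d by (intro mult_le_mono1) (simp add: s_def)
          also have "\<dots> \<le> 2 * N" using sMN by (simp only: mult.assoc mult_le_mono2)
          finally have "d * M \<le> 2 * N" .
          then have "real d * real M \<le> 2 * real N" 
            by (metis of_nat_le_iff of_nat_mult of_nat_numeral)
          then have "real d * real M * T \<le> 2 * real N * T" using T by (intro mult_right_mono) auto
          then show ?thesis using N M by (simp add: field_simps)
        qed
        then have pow: "K * (real d * (T / real N)) powr \<alpha> \<le> K * (2 * T / real M) powr \<alpha>"
          using K \<alpha> T by (intro mult_left_mono powr_mono2) auto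
        have b: "0 \<le> K * (real d * (T / real N)) powr \<alpha>" using K by simp
        have shift: "grid_norm p T N (\<lambda>k. if k + d \<le> N then g' (k + d) - g' k else 0)
            \<le> ennreal (K * (real d * (T / real N)) powr \<alpha>)"
          unfolding K_def by (rule discrete_caputo_shift_estimate[OF T N p \<alpha> B fY[unfolded g']])
        have "grid_norm p T N (\<lambda>k. if k + d \<le> N then g (k + d) - g k else 0)
            \<le> ennreal (K * (real d * (T / real N)) powr \<alpha>)"
          by (rule grid_norm_reindex_le[OF T N p b, where K = "{1..N}" and \<sigma> = "\<lambda>k. k",
                OF _ _ _ _ _ shift]) (auto simp: g'_def)
        also note ennreal_leI[OF pow]
        finally show "grid_norm p T N (\<lambda>k. if k + d \<le> N then g (k + d) - g k else 0)
            \<le> ennreal (K * (2 * T / real M) powr \<alpha>)" .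
      qed (use K in simp)
      have gA: "j (i (A m)) = block_average s g m" for m
        unfolding A_def g_def by (rule block_average_linear[OF lji])
      define c where "c b = (if b then \<delta> else C)" for b
      define w where "w b = (if b then 10 * B else 5 * (K * (2 * T / real M) powr \<alpha>))" for b
      define u where "u b t = (if b then norm (piecewise_const (T / real N) f t - piecewise_const (T / real M) A t)
          else norm (piecewise_const (T / real N) g t - piecewise_const (T / real M) (block_average s g) t))" for b t
      have "Lp_norm p L (\<lambda>t. i (piecewise_const (T / real N) f t) - i (piecewise_const (T / real M) A t))
          \<le> ennreal (\<Sum>b\<in>(UNIV::bool set). c b * w b)"
      proof (rule Lp_norm_sum_le[OF p, where u = u])
        show "(\<lambda>t. norm (u b t)) \<in> borel_measurable L" for b
          unfolding u_def L_def by (cases b) (simp_all, (rule measurable_two_grids)+)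
        show "(\<lambda>t. norm (i (piecewise_const (T / real N) f t) - i (piecewise_const (T / real M) A t))) \<in> borel_measurable L"
          unfolding L_def by (rule measurable_two_grids)
        show "Lp_norm p L (u b) \<le> ennreal (w b)" for b
          using X Y by (cases b) (simp_all add: u_def[abs_def] w_def Lp_norm_of_norm)
        show "AE t in L. norm (i (piecewise_const (T / real N) f t) - i (piecewise_const (T / real M) A t))
            \<le> (\<Sum>b\<in>UNIV. c b * norm (u b t))"
        proof (rule AE_I2)
          fix t
          define x where "x = f (grid_index T N t) - A (grid_index T M t)"
          have "norm (i x) \<le> \<delta> * norm x + C * norm (j (i x))" by (rule C(2))
          then show "norm (i (piecewise_const (T / real N) f t) - i (piecewise_const (T / real M) A t))
            \<le> (\<Sum>b\<in>UNIV. c b * norm (u b t))"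
            by (simp add: UNIV_bool u_def c_def piecewise_const_grid_index x_def g_def gA[symmetric]
                linear_diff[OF li] linear_diff[OF lj])
        qed
      qed (use \<delta> C(1) B K in \<open>auto simp: c_def w_def\<close>)
      also have "(\<Sum>b\<in>(UNIV::bool set). c b * w b) \<le> \<epsilon>"
        using \<delta>(2) small by (simp add: UNIV_bool c_def w_def)
      finally have "Lp_norm p L (\<lambda>t. i (piecewise_const (T / real N) f t) - i (piecewise_const (T / real M) A t)) \<le> ennreal \<epsilon>"
        by (simp add: ennreal_leI)
      then show ?thesis
        using Abound M MM0 by (intro bexI[of _ M] exI[of _ A]) (auto simp: L_def)
    qed
  qed
qed

text \<open>
  A finite net that is read off the family itself: the colour of a member records the grid of its
  approximant and, cell by cell, the nearest point of a finite net of the compact image of a ball. Members of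
  the same colour are close, so one representative of each colour suffices for total boundedness.
\<close>

lemma finite_colouring:
  fixes i :: "'x::real_normed_vector \<Rightarrow> 'b::real_normed_vector" and j :: "'b \<Rightarrow> 'y::real_normed_vector"
    and N :: "nat \<Rightarrow> nat"
  assumes i: "compact_embedding i" and j: "continuous_embedding j"
    and T: "0 < T" and p: "1 \<le> p" and \<alpha>: "0 < \<alpha>" "\<alpha> < 1" and B: "0 \<le> B" and \<epsilon>: "0 < \<epsilon>"
    and N: "\<And>n. 1 \<le> N n"
    and fX: "\<And>n. grid_norm p T (N n) (f n) \<le> ennreal B"
    and fY: "\<And>n. grid_norm p T (N n)
        (discrete_caputo \<alpha> (T / real (N n)) ((\<lambda>k. j (i (f n k)))(0 := f0 n))) \<le> ennreal B"
  obtains c :: "nat \<Rightarrow> nat \<times> 'b list" where "finite (range c)"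
    "\<And>m n. c m = c n \<Longrightarrow> Lp_norm p (lebesgue_on {0<..<T})
        (\<lambda>t. i (piecewise_const (T / real (N m)) (f m) t) - i (piecewise_const (T / real (N n)) (f n) t)) \<le> ennreal \<epsilon>"
proof -
  define L where "L = lebesgue_on {0<..<T}"
  have \<epsilon>3: "0 < \<epsilon> / 3" using \<epsilon> by simp
  obtain M0 R where approximable: "\<And>N f f0. \<lbrakk>1 \<le> N; grid_norm p T N f \<le> ennreal B;
      grid_norm p T N (discrete_caputo \<alpha> (T / real N) ((\<lambda>k. j (i (f k)))(0 := f0))) \<le> ennreal B\<rbrakk>
    \<Longrightarrow> \<exists>M\<in>{1..M0}. \<exists>v. (\<forall>k\<in>{1..M}. norm (v k) \<le> R) \<and>
        Lp_norm p (lebesgue_on {0<..<T})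
          (\<lambda>t. i (piecewise_const (T / real N) f t) - i (piecewise_const (T / real M) v t)) \<le> ennreal (\<epsilon> / 3)"
    by (rule coarse_approximation[OF i j T p \<alpha> B \<epsilon>3]) (rule that)
  have "\<forall>n. \<exists>M\<in>{1..M0}. \<exists>v. (\<forall>k\<in>{1..M}. norm (v k) \<le> R) \<and> Lp_norm p L
          (\<lambda>t. i (piecewise_const (T / real (N n)) (f n) t) - i (piecewise_const (T / real M) v t)) \<le> ennreal (\<epsilon> / 3)"
    unfolding L_def by (intro allI, rule approximable[OF N fX fY])
  then obtain M v where M: "\<And>n. M n \<in> {1..M0}" and vR: "\<And>n k. k \<in> {1..M n} \<Longrightarrow> norm (v n k) \<le> R"
    and approx: "\<And>n. Lp_norm p L (\<lambda>t. i (piecewise_const (T / real (N n)) (f n) t)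
        - i (piecewise_const (T / real (M n)) (v n) t)) \<le> ennreal (\<epsilon> / 3)"
    by metis
  \<comment> \<open>values at distance \<open>2 \<delta>\<close> give functions at distance \<open>\<epsilon> / 3\<close>, by \<open>grid_norm_le_sup\<close>\<close>
  define \<delta> where "\<delta> = \<epsilon> / (6 * (1 + T))"
  have \<delta>: "0 < \<delta>" "2 * \<delta> * (1 + T) = \<epsilon> / 3" using T \<epsilon> by (auto simp: \<delta>_def field_simps)
  have "compact (closure (i ` cball 0 R))"
    using i by (simp add: compact_embedding_def)
  then obtain Q where Q: "finite Q" "closure (i ` cball 0 R) \<subseteq> (\<Union>y\<in>Q. ball y \<delta>)"
    using \<delta>(1) unfolding compact_eq_totally_bounded by blast
  have "\<exists>y\<in>Q. dist y (i x) < \<delta>" if "norm x \<le> R" for x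
  proof -
    have "i x \<in> closure (i ` cball 0 R)"
      using that by (intro closure_subset[THEN subsetD]) simp
    then obtain y where "y \<in> Q" "i x \<in> ball y \<delta>" using Q(2) by blast
    then show ?thesis by (intro bexI[of _ y]) simp_all
  qed
  then obtain q where q: "\<And>x. norm x \<le> R \<Longrightarrow> q x \<in> Q \<and> dist (q x) (i x) < \<delta>"
    by metis
  define c where "c n = (M n, map (\<lambda>k. q (v n k)) [1..<Suc (M n)])" for n
  show thesis
  proof (rule that[of c])
    have "range c \<subseteq> {1..M0} \<times> {xs. set xs \<subseteq> Q \<and> length xs \<le> M0}"
      using M q vR by (fastforce simp: c_def simp del: upt_Suc)
    then show "finite (range c)"
      by (rule finite_subset) (intro finite_cartesian_product finite_lists_length_le Q(1) finite_atLeastAtMost)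
  next
    fix m n assume c: "c m = c n"
    have Mmn: "M m = M n" using c by (simp add: c_def)
    have qmn: "q (v m k) = q (v n k)" if "k \<in> {1..M n}" for k
      using c that unfolding c_def Mmn prod.inject map_eq_conv by (auto simp del: upt_Suc)
    have close: "norm (i (v m k) - i (v n k)) \<le> 2 * \<delta>" if k: "k \<in> {1..M n}" for k
    proof -
      have "dist (i (v m k)) (i (v n k)) \<le> dist (q (v m k)) (i (v m k)) + dist (q (v n k)) (i (v n k))"
        using dist_triangle3[of "i (v m k)" "i (v n k)" "q (v m k)"] qmn[OF k] by simp
      also have "\<dots> \<le> 2 * \<delta>"
        using q[OF vR, of k m] q[OF vR, of k n] k Mmn by simp
      finally show ?thesis by (simp add: dist_norm)
    qed
    have Mn: "1 \<le> M n" using M[of n] by simp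
    have "grid_norm p T (M n) (\<lambda>k. i (v m k) - i (v n k)) \<le> ennreal (2 * \<delta> * (1 + T))"
      by (rule grid_norm_le_sup[OF T Mn p _ close]) (use \<delta> in auto)
    then have mid: "Lp_norm p L (\<lambda>t. i (piecewise_const (T / real (M n)) (v m) t)
        - i (piecewise_const (T / real (M n)) (v n) t)) \<le> ennreal (\<epsilon> / 3)"
      unfolding \<delta>(2) grid_norm_def L_def piecewise_const_def .
    define F where "F n t = i (piecewise_const (T / real (N n)) (f n) t)" for n t
    define G where "G n t = i (piecewise_const (T / real (M n)) (v n) t)" for n t
    define u where "u r t = (if r = (0::nat) then F m t - G m t else if r = 1 then G m t - G n t else F n t - G n t)" for r t
    have "Lp_norm p L (\<lambda>t. F m t - F n t) \<le> ennreal (\<Sum>r\<in>{0,1,2::nat}. 1 * (\<epsilon> / 3))"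
    proof (rule Lp_norm_sum_le[OF p, where u = u])
      show "(\<lambda>t. norm (u r t)) \<in> borel_measurable L" for r
        using measurable_two_grids[of "\<lambda>x y. norm (i x - i y)"]
        by (cases "r = 0"; cases "r = 1") (simp_all add: u_def L_def F_def G_def)
      show "(\<lambda>t. norm (F m t - F n t)) \<in> borel_measurable L"
        unfolding L_def F_def by (rule measurable_two_grids)
      show "Lp_norm p L (u r) \<le> ennreal (\<epsilon> / 3)" for r
        using approx[of m] approx[of n] mid
        by (cases "r = 0"; cases "r = 1") (simp_all add: u_def[abs_def] F_def G_def Mmn)
      show "AE t in L. norm (F m t - F n t) \<le> (\<Sum>r\<in>{0,1,2::nat}. 1 * norm (u r t))"
      proof (rule AE_I2)
        fix t
        have "F m t - F n t = (F m t - G m t) + (G m t - G n t) - (F n t - G n t)" by simp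
        also have "norm \<dots> \<le> norm (F m t - G m t) + norm (G m t - G n t) + norm (F n t - G n t)"
          by (rule order_trans[OF norm_triangle_ineq4]) (intro add_right_mono norm_triangle_ineq)
        finally show "norm (F m t - F n t) \<le> (\<Sum>r\<in>{0,1,2::nat}. 1 * norm (u r t))"
          by (simp add: u_def)
      qed
    qed (use \<epsilon> in auto)
    then show "Lp_norm p (lebesgue_on {0<..<T})
        (\<lambda>t. i (piecewise_const (T / real (N m)) (f m) t) - i (piecewise_const (T / real (N n)) (f n) t)) \<le> ennreal \<epsilon>"
      by (simp add: F_def L_def)
  qed
qed

theorem theorem1p2:
  fixes i :: "'x::banach \<Rightarrow> 'b::banach" and j :: "'b \<Rightarrow> 'y::banach"
    and T \<alpha> C0 :: real and p :: ennreal
    and N :: "nat \<Rightarrow> nat" and \<tau> :: "nat \<Rightarrow> real"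
    and f0 :: "nat \<Rightarrow> 'y" and f :: "nat \<Rightarrow> nat \<Rightarrow> 'x"
  assumes "compact_embedding i" and "continuous_embedding j"
    and "0 < T" and "1 \<le> p" and "p \<le> \<infinity>" and "0 < \<alpha>" and "\<alpha> < 1"
    and "\<And>n. 1 \<le> N n" and "\<And>n. \<tau> n = T / real (N n)"
    and "\<And>n. Lp_norm p (lebesgue_on {0<..<T}) (piecewise_const (\<tau> n) (f n))
            + Lp_norm p (lebesgue_on {0<..<T})
                (piecewise_const (\<tau> n)
                  (discrete_caputo \<alpha> (\<tau> n) ((\<lambda>k. j (i (f n k)))(0 := f0 n))))
          \<le> ennreal C0"
  shows "relatively_compactin (Lp_topology p (lebesgue_on {0<..<T}))
           (range (\<lambda>n. Lp_class p (lebesgue_on {0<..<T})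
                           (\<lambda>t. i (piecewise_const (\<tau> n) (f n) t))))"
proof -
  define L where "L = lebesgue_on {0<..<T}"
  interpret complete_measure L
    unfolding L_def by (rule complete_measure_lebesgue_on) simp
  interpret Metric_space "Lp_space p L :: (real \<Rightarrow> 'b) set set" "Lp_dist p L"
    by (rule Metric_space_Lp) fact
  \<comment> \<open>for negative \<open>C0\<close> the hypothesis says that the norms vanish\<close>
  define B where "B = max C0 0"
  define F where "F n t = i (piecewise_const (\<tau> n) (f n) t)" for n t
  define cls where "cls n = Lp_class p L (F n)" for n
  note T = \<open>0 < T\<close> and p = \<open>1 \<le> p\<close>
  have B: "0 \<le> B" "ennreal C0 = ennreal B"
    by (auto simp: B_def max_def ennreal_neg)
  have fX: "grid_norm p T (N n) (f n) \<le> ennreal B" for n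
    using order_trans[OF add_increasing2[OF zero_le order_refl] assms(10)[of n]] B(2)
    by (simp add: grid_norm_def assms(9))
  have fY: "grid_norm p T (N n)
      (discrete_caputo \<alpha> (T / real (N n)) ((\<lambda>k. j (i (f n k)))(0 := f0 n))) \<le> ennreal B" for n
    using order_trans[OF add_increasing[OF zero_le order_refl] assms(10)[of n]] B(2)
    by (simp add: grid_norm_def assms(9))
  have simple: "simple_function L (F n)" for n
    unfolding L_def F_def assms(9) by (rule simple_function_piecewise_const[OF T assms(8)])
  have sm: "strongly_measurable L (F n)" for n
    by (rule simple_function_strongly_measurable[OF simple])
  obtain K where K: "\<And>x. norm (i x) \<le> K * norm x" "0 \<le> K"
  proof -
    have "bounded_linear i" using assms(1) by (simp add: compact_embedding_def continuous_embedding_def)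
    then obtain K where "0 < K" "\<And>x. norm (i x) \<le> norm x * K"
      using bounded_linear.pos_bounded by blast
    then show thesis using that[of K] by (simp add: mult.commute)
  qed
  have Fnorm: "Lp_norm p L (F n) \<le> ennreal (K * B)" for n
  proof -
    have "Lp_norm p L (F n) \<le> Lp_norm p L (\<lambda>t. K * norm (piecewise_const (\<tau> n) (f n) t))"
      by (rule Lp_norm_mono_AE[OF strongly_measurable_norm[OF sm]]) (auto simp: F_def K abs_mult)
    also have "\<dots> \<le> ennreal (K * B)"
    proof (rule Lp_norm_scale_le[OF p B(1) K(2)])
      show "(\<lambda>t. norm (piecewise_const (\<tau> n) (f n) t)) \<in> borel_measurable L"
        unfolding L_def assms(9) by (rule measurable_piecewise_const)
      show "Lp_norm p L (piecewise_const (\<tau> n) (f n)) \<le> ennreal B"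
        using fX[of n] by (simp add: grid_norm_def L_def assms(9))
    qed
    finally show ?thesis .
  qed
  have F: "F n \<in> Lp_fun p L" for n
    using sm[of n] order.strict_trans1[OF Fnorm[of n]] by (simp add: Lp_fun_def)
  have cls_space: "Lp_class p L g \<in> Lp_space p L" if "g \<in> Lp_fun p L" for g :: "real \<Rightarrow> 'b"
    using that by (auto simp: Lp_space_def Lp_class_def intro: quotientI)
  have cls: "cls n \<in> Lp_space p L" for n
    unfolding cls_def by (rule cls_space[OF F])
  have dist: "Lp_dist p L (Lp_class p L g) (Lp_class p L h) \<le> e"
    if "g \<in> Lp_fun p L" "h \<in> Lp_fun p L" "0 \<le> e" "Lp_norm p L (\<lambda>t. g t - h t) \<le> ennreal e" for g h :: "real \<Rightarrow> 'b" and e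
    using that enn2real_mono[of "Lp_norm p L (\<lambda>t. g t - h t)" "ennreal e"] by (simp add: Lp_dist_class)
  have "mtotally_bounded (range cls)"
    unfolding mtotally_bounded_def
  proof (intro allI impI)
    fix \<epsilon> :: real assume \<epsilon>: "0 < \<epsilon>"
    then have \<epsilon>2: "0 < \<epsilon> / 2" by simp
    obtain c :: "nat \<Rightarrow> nat \<times> 'b list" where c: "finite (range c)"
      "\<And>m n. c m = c n \<Longrightarrow> Lp_norm p (lebesgue_on {0<..<T})
        (\<lambda>t. i (piecewise_const (T / real (N m)) (f m) t) - i (piecewise_const (T / real (N n)) (f n) t)) \<le> ennreal (\<epsilon> / 2)"
      by (rule finite_colouring[OF assms(1,2) T p assms(6,7) B(1) \<epsilon>2 assms(8) fX fY]) (rule that)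
    define pick where "pick a = (SOME n. c n = a)" for a
    have pick: "c (pick (c n)) = c n" for n
      unfolding pick_def by (rule someI[of _ n]) simp
    have near: "Lp_dist p L (cls (pick (c n))) (cls n) < \<epsilon>" for n
    proof -
      have "Lp_dist p L (cls (pick (c n))) (cls n) \<le> \<epsilon> / 2"
        unfolding cls_def using c(2)[OF pick[of n]] \<epsilon>
        by (intro dist F) (auto simp: F_def[abs_def] L_def assms(9))
      then show ?thesis using \<epsilon> by simp
    qed
    have "range cls \<subseteq> (\<Union>x\<in>cls ` pick ` range c. mball x \<epsilon>)"
    proof
      fix x assume "x \<in> range cls"
      then obtain n where "x = cls n" by auto
      then have "x \<in> mball (cls (pick (c n))) \<epsilon>" using near[of n] cls by simp
      then show "x \<in> (\<Union>x\<in>cls ` pick ` range c. mball x \<epsilon>)" by blast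
    qed
    then show "\<exists>K. finite K \<and> K \<subseteq> range cls \<and> range cls \<subseteq> (\<Union>x\<in>K. mball x \<epsilon>)"
      using c(1) by (intro exI[of _ "cls ` pick ` range c"]) auto
  qed
  moreover have "\<exists>l. limitin mtopology \<sigma> l sequentially" if \<sigma>: "range \<sigma> \<subseteq> range cls" "MCauchy \<sigma>" for \<sigma>
  proof -
    have "\<forall>n. \<exists>k. \<sigma> n = cls k" using \<sigma>(1) by blast
    then obtain k where k: "\<And>n. \<sigma> n = cls (k n)" by metis
    have fin: "Lp_norm p L (\<lambda>t. F m t - F n t) < \<infinity>" for m n
      by (rule Lp_norm_diff_finite[OF p F F])
    have Cauchy: "\<exists>K. \<forall>m\<ge>K. \<forall>n\<ge>K. Lp_norm p L (\<lambda>t. F (k m) t - F (k n) t) \<le> ennreal e" if e: "0 < e" for e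
    proof -
      obtain K where "\<And>m n. K \<le> m \<Longrightarrow> K \<le> n \<Longrightarrow> Lp_dist p L (cls (k m)) (cls (k n)) < e"
        using \<sigma>(2) e unfolding MCauchy_def k by meson
      then have "Lp_norm p L (\<lambda>t. F (k m) t - F (k n) t) \<le> ennreal e" if "K \<le> m" "K \<le> n" for m n
        using that fin[of "k m" "k n"] unfolding cls_def Lp_dist_class[OF F F]
        by (metis ennreal_enn2real ennreal_leI infinity_ennreal_def less_imp_le)
      then show ?thesis by blast
    qed
    obtain g where g: "strongly_measurable L g"
      "\<And>e. 0 < e \<Longrightarrow> \<exists>K. \<forall>n\<ge>K. Lp_norm p L (\<lambda>t. F (k n) t - g t) \<le> ennreal e"
      by (rule Lp_Cauchy_simple_convergent[OF p simple Cauchy]) (assumption, rule that)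
    have gL: "g \<in> Lp_fun p L"
    proof -
      obtain n where n: "Lp_norm p L (\<lambda>t. F (k n) t - g t) \<le> ennreal 1" using g(2)[of 1] by auto
      have "Lp_norm p L g \<le> Lp_norm p L (F (k n)) + Lp_norm p L (\<lambda>t. F (k n) t - g t)"
      proof (rule Lp_norm_triangle[OF p])
        show "norm (g t) \<le> norm (F (k n) t) + norm (F (k n) t - g t)" for t
          using norm_triangle_sub[of "g t" "F (k n) t"] by (simp add: norm_minus_commute)
      qed (intro strongly_measurable_norm strongly_measurable_diff sm g(1))+
      also have "\<dots> < \<infinity>" using F[of "k n"] n by (auto simp: Lp_fun_def intro: le_less_trans)
      finally show ?thesis using g(1) by (simp add: Lp_fun_def)
    qed
    have "limitin mtopology \<sigma> (Lp_class p L g) sequentially"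
      unfolding limit_metric_sequentially
    proof (intro conjI allI impI)
      show "Lp_class p L g \<in> Lp_space p L" by (rule cls_space[OF gL])
      fix \<epsilon> :: real assume \<epsilon>: "0 < \<epsilon>"
      then obtain K where K: "\<And>n. K \<le> n \<Longrightarrow> Lp_norm p L (\<lambda>t. F (k n) t - g t) \<le> ennreal (\<epsilon> / 2)"
        using g(2)[of "\<epsilon> / 2"] by auto
      have "Lp_dist p L (\<sigma> n) (Lp_class p L g) < \<epsilon>" if "K \<le> n" for n
        using dist[OF F gL _ K[OF that]] \<epsilon> by (simp add: k cls_def)
      then show "\<exists>K. \<forall>n\<ge>K. \<sigma> n \<in> Lp_space p L \<and> Lp_dist p L (\<sigma> n) (Lp_class p L g) < \<epsilon>"
        using cls k by auto
    qed
    then show ?thesis by blast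
  qed
  ultimately have "compactin mtopology (mtopology closure_of (range cls))"
    by (rule compactin_closure_of_totally_bounded)
  moreover have "range cls \<subseteq> topspace mtopology" using cls by auto
  ultimately have "relatively_compactin mtopology (range cls)"
    by (simp add: relatively_compactin_def)
  then show ?thesis
    unfolding Lp_topology_def L_def[symmetric] cls_def[abs_def] F_def[abs_def] .
qed

end
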